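(* Let $R$ be a ring, let $M=\bigoplus_{i=1}^nM_i$ be a direct sum of l-finite Euclidean $R$-modules $M_i$, let $0\neq A\in M_{m,n}(M_1,\ldots,M_n)$, $\mathbb{P}_s(N(A))=\{j_1,\ldots,j_s\}$ where $j_1<\cdots<j_s$, and let $A\sim_sB$ where the matrix $B=(b_1,\ldots,b_s)^t$ with rows $b_\nu=(0,\ldots,0,b_{\nu j_\nu},\ldots,b_{\nu n})$, $\nu=1,\ldots,s$, is in strong reduced echelon form. Then: (1) $l_R(N(A))<\infty$ if and only if $l_R(M_j)<\infty$ for all $j\in\mathbb{P}_s(N(A))$. If $l_R(N(A))<\infty$ then $l_R(N(A))=\sum_{\nu=1}^sl_R(Rb_{\nu j_\nu})$. (2) $l_R(M/N(A))<\infty$ if and only if $l_R(M_j)<\infty$ for all $j\in\{1,\ldots,n\}\setminus\mathbb{P}_s(N(A))$. If $l_R(M/N(A))<\infty$ then $$l_R(M/N(A))=\sum_{\nu=1}^sl_R(M_{j_\nu}/Rb_{\nu j_\nu})+\sum_{j\in\{1,\ldots,n\}\setminus\mathbb{P}_s(N(A))}l_R(M_j).$$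
   Context: Rings are unital and modules are left modules; $l_R$ denotes length. A poset is Artinian if every descending chain in it stabilizes. For $i\le j$ in a poset, $[i,j]:=\{k:i\le k\le j\}$ and $l([i,j]):=\sup\{k\in\mathbb{N}:\text{there is a chain } i=i_1<\cdots<i_k=j\}$. An $R$-module $E$ is a Euclidean module if there is a function $d_E:E\setminus\{0\}\to P$ to a poset (the degree) such that $\mathrm{im}(d_E)$ is an Artinian poset and, for any nonzero $u,v\in E$, there are $q\in R$ and $r\in E$ with $u=qv+r$ and either $r=0$ or $d_E(r)<d_E(v)$. For a nonzero submodule $N\subseteq E$, $g(N):=\min\{d_E(x):0\neq x\in N\}$ (the least value; it is presupposed to exist). $E$ is l-finite if every interval in $\mathrm{im}(d_E)$ has finite length, equivalently $l([g(E),d_E(m)])<\infty$ for all nonzero $m\in E$. $M_{m,n}(M_1,\ldots,M_n)$ is the set of $m\times n$ matrices $(a_{ij})$ with $a_{ij}\in M_j$; the rows $a_i$ are elements of $M$, and $N(A):=\sum_iRa_i$. Elementary row operations: (ER1) $a_i\mapsto a_i+\sum_{j\neq i}r_ja_j$, $r_j\in R$; (ER2) swapping two rows; (ER0) replacing a zero row by $\sum_ir_ia_i$, $r_i\in R$. Matrices are considered up to adding or deleting zero rows. $A\sim_sA'$ means one matrix is obtained from the other by finitely many operations (ER0), (ER1), (ER2). Put $M_{\ge i}:=M_i\oplus\cdots\oplus M_n$, $M_{\ge n+1}:=0$. For a submodule $N\subseteq M$ let $N_{\ge i}:=N\cap M_{\ge i}$ and $\mathrm{gr}(N)_i:=N_{\ge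 i}/N_{\ge i+1}$, identified with a submodule of $M_i$ via projection. $\mathbb{P}_s(N):=\{i:\mathrm{gr}(N)_i\neq0\}$. A nonzero matrix $B$ with rows $b_1,\ldots,b_s$, where, for $N=N(B)$, $\mathbb{P}_s(N)=\{j_1<\cdots<j_s\}$, is in strong reduced echelon form if: (1) for each $\nu$, $N_{\ge j_\nu}=\sum_{\mu=\nu}^sRb_\mu$, and $b_{\nu j_\nu}$ has the least degree among the nonzero elements of $\mathrm{gr}(N)_{j_\nu}=Rb_{\nu j_\nu}$; (2) each of $b_{1j_\nu},\ldots,b_{\nu-1,j_\nu}$ is zero or has degree strictly less than that of $b_{\nu j_\nu}$ in $M_{j_\nu}$. *)

theory Defs
  imports "HOL-Algebra.Module" "HOL-Algebra.AbelCoset" "HOL-Library.Extended_Nat"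
begin

text \<open>
  The library locale \<open>module\<close> requires a commutative ring; the following is the same
  axiomatisation over an arbitrary unital ring.  The library predicate \<open>submodule\<close> does not
  depend on commutativity and is used as it stands.
\<close>

locale left_module = R?: ring R + M?: abelian_group M for R (structure) and M (structure) +
  assumes smult_closed [simp, intro]:
      "\<lbrakk> a \<in> carrier R; x \<in> carrier M \<rbrakk> \<Longrightarrow> a \<odot>\<^bsub>M\<^esub> x \<in> carrier M"
    and smult_l_distr:
      "\<lbrakk> a \<in> carrier R; b \<in> carrier R; x \<in> carrier M \<rbrakk> \<Longrightarrow>
        (a \<oplus> b) \<odot>\<^bsub>M\<^esub> x = a \<odot>\<^bsub>M\<^esub> x \<oplus>\<^bsub>M\<^esub> b \<odot>\<^bsub>M\<^esub> x"
    and smult_r_distr: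
      "\<lbrakk> a \<in> carrier R; x \<in> carrier M; y \<in> carrier M \<rbrakk> \<Longrightarrow>
        a \<odot>\<^bsub>M\<^esub> (x \<oplus>\<^bsub>M\<^esub> y) = a \<odot>\<^bsub>M\<^esub> x \<oplus>\<^bsub>M\<^esub> a \<odot>\<^bsub>M\<^esub> y"
    and smult_assoc1:
      "\<lbrakk> a \<in> carrier R; b \<in> carrier R; x \<in> carrier M \<rbrakk> \<Longrightarrow>
        (a \<otimes> b) \<odot>\<^bsub>M\<^esub> x = a \<odot>\<^bsub>M\<^esub> (b \<odot>\<^bsub>M\<^esub> x)"
    and smult_one [simp]:
      "x \<in> carrier M \<Longrightarrow> \<one> \<odot>\<^bsub>M\<^esub> x = x"

definition submodule_as_module ::
    "('r, 'm, 'y) module_scheme \<Rightarrow> 'm set \<Rightarrow> ('r, 'm, 'y) module_scheme" where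
  "submodule_as_module M N = M\<lparr>carrier := N\<rparr>"

text \<open>The fields \<open>mult\<close> and \<open>one\<close> of a module record carry no meaning.\<close>

definition quotient_module ::
    "('r, 'm, 'y) module_scheme \<Rightarrow> 'm set \<Rightarrow> ('r, 'm set) module" where
  "quotient_module M N =
    \<lparr>carrier = a_rcosets\<^bsub>M\<^esub> N, mult = undefined, one = undefined,
     zero = N, add = set_add M,
     smult = (\<lambda>r X. \<Union>x\<in>X. N +>\<^bsub>M\<^esub> (r \<odot>\<^bsub>M\<^esub> x))\<rparr>"

text \<open>Length as the supremum of the lengths of strict chains of submodules.\<close>

definition module_length :: "('r, 'x) ring_scheme \<Rightarrow> ('r, 'm, 'y) module_scheme \<Rightarrow> enat" where
  "module_length R M =
    Sup {enat k | k. \<exists>N. (\<forall>i\<le>k. submodule (N i) R M) \<and> (\<forall>i<k. N i \<subset> N (Suc i))}"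

definition cyclic_submodule ::
    "('r, 'x) ring_scheme \<Rightarrow> ('r, 'm, 'y) module_scheme \<Rightarrow> 'm \<Rightarrow> 'm set" where
  "cyclic_submodule R M x = {r \<odot>\<^bsub>M\<^esub> x | r. r \<in> carrier R}"

definition direct_sum_module ::
    "(nat \<Rightarrow> ('r, 'm, 'y) module_scheme) \<Rightarrow> nat \<Rightarrow> ('r, nat \<Rightarrow> 'm) module" where
  "direct_sum_module M n =
    \<lparr>carrier = (\<Pi>\<^sub>E i\<in>{1..n}. carrier (M i)), mult = undefined, one = undefined,
     zero = (\<lambda>i\<in>{1..n}. \<zero>\<^bsub>M i\<^esub>),
     add = (\<lambda>x y. \<lambda>i\<in>{1..n}. x i \<oplus>\<^bsub>M i\<^esub> y i),
     smult = (\<lambda>r x. \<lambda>i\<in>{1..n}. r \<odot>\<^bsub>M i\<^esub> x i)\<rparr>"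


section \<open>Euclidean modules\<close>

locale euclidean_module = left_module R E + partial_order P
  for R (structure) and E (structure) and P (structure) +
  fixes d :: "'m \<Rightarrow> 'p"
  assumes degree_closed: "d \<in> carrier E - {\<zero>\<^bsub>E\<^esub>} \<rightarrow> carrier P"
    and artinian:
      "\<lbrakk> \<And>i::nat. c i \<in> d ` (carrier E - {\<zero>\<^bsub>E\<^esub>}); \<And>i. c (Suc i) \<sqsubseteq>\<^bsub>P\<^esub> c i \<rbrakk> \<Longrightarrow>
        \<exists>k. \<forall>i\<ge>k. c i = c k"
    and division:
      "\<lbrakk> u \<in> carrier E - {\<zero>\<^bsub>E\<^esub>}; v \<in> carrier E - {\<zero>\<^bsub>E\<^esub>} \<rbrakk> \<Longrightarrow>
        \<exists>q\<in>carrier R. \<exists>r\<in>carrier E.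
          u = q \<odot>\<^bsub>E\<^esub> v \<oplus>\<^bsub>E\<^esub> r \<and> (r = \<zero>\<^bsub>E\<^esub> \<or> d r \<sqsubset>\<^bsub>P\<^esub> d v)"

text \<open>\<open>x\<close> is a nonzero element of \<open>N\<close> whose degree is the least value \<open>g(N)\<close>.\<close>

definition least_degree_in ::
    "('r, 'm, 'y) module_scheme \<Rightarrow> 'p gorder \<Rightarrow> ('m \<Rightarrow> 'p) \<Rightarrow> 'm set \<Rightarrow> 'm \<Rightarrow> bool" where
  "least_degree_in E P d N x \<longleftrightarrow>
    x \<in> N - {\<zero>\<^bsub>E\<^esub>} \<and> (\<forall>y\<in>N - {\<zero>\<^bsub>E\<^esub>}. d x \<sqsubseteq>\<^bsub>P\<^esub> d y)"

definition interval_length :: "'p gorder \<Rightarrow> 'p \<Rightarrow> 'p \<Rightarrow> enat" where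
  "interval_length P a b =
    Sup {enat (length c) | c. c \<noteq> [] \<and> set c \<subseteq> carrier P \<and>
      sorted_wrt (lless P) c \<and> hd c = a \<and> last c = b}"

text \<open>
  A descending chain condition only yields minimal degrees; that \<open>g(N)\<close> exists as a least
  value for every nonzero submodule \<open>N\<close> is a separate requirement.
\<close>

locale l_finite_euclidean_module = euclidean_module R E P d
  for R (structure) and E (structure) and P (structure) and d +
  assumes least_degree_exists:
      "\<lbrakk> submodule N R E; N \<noteq> {\<zero>\<^bsub>E\<^esub>} \<rbrakk> \<Longrightarrow> \<exists>x. least_degree_in E P d N x"
    and finite_intervals:
      "\<lbrakk> a \<in> d ` (carrier E - {\<zero>\<^bsub>E\<^esub>}); b \<in> d ` (carrier E - {\<zero>\<^bsub>E\<^esub>}); a \<sqsubseteq>\<^bsub>P\<^esub> b \<rbrakk> \<Longrightarrow>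
        interval_length (P\<lparr>carrier := d ` (carrier E - {\<zero>\<^bsub>E\<^esub>})\<rparr>) a b < \<infinity>"


section \<open>Matrices and row operations\<close>

text \<open>
  A matrix is the list of its rows, which are elements of \<open>direct_sum_module M n\<close>.  Rows are
  numbered from 0, columns from 1.
\<close>

definition module_matrices ::
    "(nat \<Rightarrow> ('r, 'm, 'y) module_scheme) \<Rightarrow> nat \<Rightarrow> nat \<Rightarrow> (nat \<Rightarrow> 'm) list set" where
  "module_matrices M m n = {A. length A = m \<and> set A \<subseteq> carrier (direct_sum_module M n)}"

definition nonzero_matrix ::
    "(nat \<Rightarrow> ('r, 'm, 'y) module_scheme) \<Rightarrow> nat \<Rightarrow> (nat \<Rightarrow> 'm) list \<Rightarrow> bool" where
  "nonzero_matrix M n A \<longleftrightarrow> (\<exists>a\<in>set A. a \<noteq> \<zero>\<^bsub>direct_sum_module M n\<^esub>)"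

text \<open>The submodule \<open>N(A)\<close> of a module \<open>D\<close> generated by the rows of \<open>A\<close>.\<close>

definition row_module ::
    "('r, 'x) ring_scheme \<Rightarrow> ('r, 'a, 'y) module_scheme \<Rightarrow> 'a list \<Rightarrow> 'a set" where
  "row_module R D A =
    {\<Oplus>\<^bsub>D\<^esub>i\<in>{..<length A}. r i \<odot>\<^bsub>D\<^esub> A ! i | r. r \<in> {..<length A} \<rightarrow> carrier R}"

text \<open>
  The rules \<open>add_zero_row\<close> and \<open>delete_zero_row\<close> implement the convention that matrices are
  considered up to zero rows.
\<close>

inductive row_step ::
    "('r, 'x) ring_scheme \<Rightarrow> ('r, 'a, 'y) module_scheme \<Rightarrow> 'a list \<Rightarrow> 'a list \<Rightarrow> bool"
  for R and D where
  ER0: "\<lbrakk> i < length A; A ! i = \<zero>\<^bsub>D\<^esub>; r \<in> {..<length A} \<rightarrow> carrier R \<rbrakk> \<Longrightarrow>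
    row_step R D A (A[i := (\<Oplus>\<^bsub>D\<^esub>j\<in>{..<length A}. r j \<odot>\<^bsub>D\<^esub> A ! j)])"
| ER1: "\<lbrakk> i < length A; r \<in> {..<length A} - {i} \<rightarrow> carrier R \<rbrakk> \<Longrightarrow>
    row_step R D A (A[i := A ! i \<oplus>\<^bsub>D\<^esub> (\<Oplus>\<^bsub>D\<^esub>j\<in>{..<length A} - {i}. r j \<odot>\<^bsub>D\<^esub> A ! j)])"
| ER2: "\<lbrakk> i < length A; j < length A \<rbrakk> \<Longrightarrow> row_step R D A (A[i := A ! j, j := A ! i])"
| add_zero_row: "row_step R D (A @ B) (A @ \<zero>\<^bsub>D\<^esub> # B)"
| delete_zero_row: "row_step R D (A @ \<zero>\<^bsub>D\<^esub> # B) (A @ B)"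

definition row_equiv ::
    "('r, 'x) ring_scheme \<Rightarrow> ('r, 'a, 'y) module_scheme \<Rightarrow> 'a list \<Rightarrow> 'a list \<Rightarrow> bool" where
  "row_equiv R D A B \<longleftrightarrow> (row_step R D)\<^sup>*\<^sup>* A B \<or> (row_step R D)\<^sup>*\<^sup>* B A"


section \<open>Strong reduced echelon form\<close>

text \<open>\<open>N\<^sub>\<ge>\<^sub>i\<close>, for a submodule \<open>N\<close> of the direct sum.\<close>

definition tail_part ::
    "(nat \<Rightarrow> ('r, 'm, 'y) module_scheme) \<Rightarrow> nat \<Rightarrow> (nat \<Rightarrow> 'm) set \<Rightarrow> nat \<Rightarrow> (nat \<Rightarrow> 'm) set" where
  "tail_part M n N i = {x \<in> N. \<forall>k\<in>{1..n}. k < i \<longrightarrow> x k = \<zero>\<^bsub>M k\<^esub>}"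

text \<open>
  \<open>gr(N)\<^sub>i = N\<^sub>\<ge>\<^sub>i / N\<^sub>\<ge>\<^sub>i\<^sub>+\<^sub>1\<close>, identified with its image under the projection to \<open>M\<^sub>i\<close>.
\<close>

definition graded_part ::
    "(nat \<Rightarrow> ('r, 'm, 'y) module_scheme) \<Rightarrow> nat \<Rightarrow> (nat \<Rightarrow> 'm) set \<Rightarrow> nat \<Rightarrow> 'm set" where
  "graded_part M n N i = (\<lambda>x. x i) ` tail_part M n N i"

definition strong_pivots ::
    "(nat \<Rightarrow> ('r, 'm, 'y) module_scheme) \<Rightarrow> nat \<Rightarrow> (nat \<Rightarrow> 'm) set \<Rightarrow> nat set" where
  "strong_pivots M n N = {i \<in> {1..n}. graded_part M n N i \<noteq> {\<zero>\<^bsub>M i\<^esub>}}"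

text \<open>The increasing list \<open>js\<close> enumerates the pivot columns \<open>j\<^sub>1 < \<dots> < j\<^sub>s\<close>.\<close>

definition strong_reduced_echelon ::
    "('r, 'x) ring_scheme \<Rightarrow> (nat \<Rightarrow> ('r, 'm, 'y) module_scheme) \<Rightarrow> nat \<Rightarrow>
     (nat \<Rightarrow> 'p gorder) \<Rightarrow> (nat \<Rightarrow> 'm \<Rightarrow> 'p) \<Rightarrow> (nat \<Rightarrow> 'm) list \<Rightarrow> bool" where
  "strong_reduced_echelon R M n P d B \<longleftrightarrow>
    nonzero_matrix M n B \<and>
    (let D = direct_sum_module M n; N = row_module R D B in
     \<exists>js. sorted_wrt (<) js \<and> set js = strong_pivots M n N \<and>
       B \<in> module_matrices M (length js) n \<and>
       (\<forall>\<nu><length js.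
         tail_part M n N (js ! \<nu>) = row_module R D (drop \<nu> B) \<and>
         graded_part M n N (js ! \<nu>) = cyclic_submodule R (M (js ! \<nu>)) ((B ! \<nu>) (js ! \<nu>)) \<and>
         least_degree_in (M (js ! \<nu>)) (P (js ! \<nu>)) (d (js ! \<nu>))
           (graded_part M n N (js ! \<nu>)) ((B ! \<nu>) (js ! \<nu>)) \<and>
         (\<forall>\<mu><\<nu>. (B ! \<mu>) (js ! \<nu>) = \<zero>\<^bsub>M (js ! \<nu>)\<^esub> \<or>
           d (js ! \<nu>) ((B ! \<mu>) (js ! \<nu>)) \<sqsubset>\<^bsub>P (js ! \<nu>)\<^esub> d (js ! \<nu>) ((B ! \<nu>) (js ! \<nu>)))))"

end

theory Submission
  imports Defs
begin

text \<open>
  A length is the supremum of the lengths of strict chains in an interval \<open>[N, L]\<close> of the submodule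
  lattice.  For \<open>N \<subseteq> L \<subseteq> M\<close> the map \<open>X \<mapsto> (gr(X)\<^sub>1, \<dots>, gr(X)\<^sub>n)\<close> is jointly strictly monotone on
  \<open>[N, L]\<close>, so the length of \<open>[N, L]\<close> is at most the sum of the lengths of the intervals
  \<open>[gr(N)\<^sub>i, gr(L)\<^sub>i]\<close>; conversely, chains in these intervals lift to consecutive layers of the
  filtration \<open>N + L\<^sub>\<ge>\<^sub>i\<close>.  With \<open>[0, N]\<close> and \<open>[N, M]\<close> this gives both length formulas.  The finiteness
  criteria follow since \<open>M\<^sub>j / R b\<close> has finite length for nonzero \<open>b\<close>: submodules are generated by
  their elements of least degree, so least degrees strictly decrease along a chain of submodules
  above \<open>R b\<close>, inside the finite interval \<open>[g(M\<^sub>j), d(b)]\<close>.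
\<close>

section \<open>Strict chains of sets\<close>

text \<open>Lengths are suprema in \<open>enat\<close> and may be infinite, so composition series
  need not exist and each equality is split into two inequalities. For an upper bound, one strict
  chain is sent to several coordinates; in each of them it may become stationary, so the strict
  steps are counted coordinate by coordinate. For a lower bound, every finite number below a
  possibly infinite sum has to be realised by a single chain glued from pieces. The matrices enter
  through two facts: row operations preserve the row module, so N(A) = N(B), and the echelon form
  says that gr(N)_j = Rb with b nonzero in a pivot column j. By definition of the pivots, gr(N)_j =
  0 in every other column. So a pivot column contributes l(Rb) to the length of N and l(M_j/Rb) to
  that of M/N, and any other column contributes 0 and l(M_j).\<close>

definition strict_chain :: "'a set set \<Rightarrow> nat \<Rightarrow> (nat \<Rightarrow> 'a set) \<Rightarrow> bool" where
  "strict_chain S k N \<longleftrightarrow> (\<forall>i\<le>k. N i \<in> S) \<and> (\<forall>i<k. N i \<subset> N (Suc i))"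

text \<open>Stated for an arbitrary family of sets, so that submodule lattices, intervals in them,
  images of such intervals and unions of layers are all measured by the same notion.\<close>

definition chain_length :: "'a set set \<Rightarrow> enat" where
  "chain_length S = Sup {enat k | k. \<exists>N. strict_chain S k N}"

lemma module_length_eq: "module_length R M = chain_length {X. submodule X R M}"
  unfolding module_length_def chain_length_def strict_chain_def by simp

lemma strict_chain_le_chain_length: "strict_chain S k N \<Longrightarrow> enat k \<le> chain_length S"
  unfolding chain_length_def by (rule Sup_upper) blast

lemma strict_chain_less:
  assumes "strict_chain S k N" "i < j" "j \<le> k"
  shows "N i \<subset> N j"
  using assms(2,3)
proof (induction j)
  case (Suc j)
  have "N j \<subset> N (Suc j)" using assms(1) Suc.prems by (simp add: strict_chain_def)
  then show ?case using Suc by (cases "i = j") auto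
qed simp

lemma chain_length_le:
  assumes "\<And>k N. strict_chain S k N \<Longrightarrow> enat k \<le> b"
  shows "chain_length S \<le> b"
  unfolding chain_length_def by (rule Sup_least) (use assms in blast)

lemma chain_length_mono: "S \<subseteq> T \<Longrightarrow> chain_length S \<le> chain_length T"
proof (rule chain_length_le)
  fix k N assume "S \<subseteq> T" "strict_chain S k N"
  then have "strict_chain T k N" unfolding strict_chain_def by blast
  then show "enat k \<le> chain_length T" by (rule strict_chain_le_chain_length)
qed

lemma chain_length_map_le:
  assumes "f ` S \<subseteq> T" "\<And>X Y. \<lbrakk> X \<in> S; Y \<in> S; X \<subset> Y \<rbrakk> \<Longrightarrow> f X \<subset> f Y"
  shows "chain_length S \<le> chain_length T"
proof (rule chain_length_le)
  fix k N assume "strict_chain S k N"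
  then have "strict_chain T k (f \<circ> N)"
    using assms unfolding strict_chain_def by (auto simp: image_subset_iff)
  then show "enat k \<le> chain_length T" by (rule strict_chain_le_chain_length)
qed

lemma chain_length_singleton: "chain_length {X} = 0"
proof -
  have "k = 0" if "strict_chain {X} k N" for k N
    using that unfolding strict_chain_def by (cases k) (auto dest: spec[of _ 0])
  then have "chain_length {X} \<le> 0" by (intro chain_length_le) (force simp: zero_enat_def)
  then show ?thesis by simp
qed

text \<open>Initial segments of chains are chains, so every finite number up to the supremum is the
  length of an actual chain. The family must be nonempty because the empty one has length 0 but
  contains no chain at all.\<close>

lemma ex_strict_chain:
  assumes "enat k \<le> chain_length S" "S \<noteq> {}"
  obtains N where "strict_chain S k N"
proof (cases k)
  case 0
  obtain X where "X \<in> S" using assms(2) by blast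
  then have "strict_chain S k (\<lambda>_. X)" using 0 by (simp add: strict_chain_def)
  then show ?thesis by (rule that)
next
  case (Suc l)
  \<comment> \<open>Writing \<open>k\<close> as a successor gives a strict bound, and a strict bound
    below a supremum is exceeded by an actual member.\<close>
  then have "enat l < chain_length S" using assms(1) by (metis Suc_ile_eq)
  then obtain k' N where "l < k'" "strict_chain S k' N"
    unfolding chain_length_def less_Sup_iff by auto
  then have "strict_chain S k N" using Suc unfolding strict_chain_def by auto
  then show ?thesis by (rule that)
qed

text \<open>As much of \<open>k\<close> as \<open>a\<close> admits is assigned to the first part;
  truncated subtraction leaves the remainder, possibly 0, for \<open>b\<close>.\<close>

lemma enat_le_addE:
  assumes "enat k \<le> a + b"
  obtains i j where "k = i + j" "enat i \<le> a" "enat j \<le> b"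
proof (cases a)
  case (enat a')
  show ?thesis
  proof (rule that)
    show "k = min k a' + (k - a')" by simp
    show "enat (min k a') \<le> a" using enat by simp
    show "enat (k - a') \<le> b" using assms enat by (cases b) auto
  qed
next
  case infinity
  then show ?thesis using that[of k 0] by (simp add: zero_enat_def[symmetric])
qed

text \<open>Reduces lower bounds to finite numbers, which can be realised by chains; infinite sums
  are thereby treated together with finite ones.\<close>

lemma enat_le_iff: "a \<le> b \<longleftrightarrow> (\<forall>k. enat k \<le> a \<longrightarrow> enat k \<le> b)" for a b :: enat
proof
  assume *: "\<forall>k. enat k \<le> a \<longrightarrow> enat k \<le> b"
  show "a \<le> b"
  proof (cases a)
    case infinity
    have "b = \<infinity>"
    proof (rule ccontr)
      assume "b \<noteq> \<infinity>"
      then obtain l where "b = enat l" by auto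
      then show False using *[rule_format, of "Suc l"] infinity by simp
    qed
    then show ?thesis by simp
  qed (use * in auto)
qed (use order_trans in blast)

text \<open>A chain in \<open>S\<close> is continued by a chain in \<open>T\<close>. The case of an
  empty family is separate, since there is then no chain to glue although the length is 0.\<close>

lemma chain_length_superadd:
  assumes "S \<union> T \<subseteq> U" "\<And>X Y. \<lbrakk> X \<in> S; Y \<in> T \<rbrakk> \<Longrightarrow> X \<subseteq> Y"
  shows "chain_length S + chain_length T \<le> chain_length U"
proof (cases "S = {} \<or> T = {}")
  case True
  have "chain_length ({} :: 'a set set) = 0"
    using chain_length_mono[of "{}" "{undefined :: 'a set}"] by (simp add: chain_length_singleton)
  then show ?thesis using True assms(1) by (auto intro: chain_length_mono)
next
  case False
  show ?thesis
  proof (subst enat_le_iff, intro allI impI)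
    fix k assume "enat k \<le> chain_length S + chain_length T"
    then obtain i j where k: "k = i + j" and ij: "enat i \<le> chain_length S" "enat j \<le> chain_length T"
      by (rule enat_le_addE)
    obtain N where N: "strict_chain S i N" using ex_strict_chain ij False by blast
    obtain N' where N': "strict_chain T j N'" using ex_strict_chain ij False by blast
    \<comment> \<open>The top term \<open>N i\<close> is left out: it may equal \<open>N' 0\<close>,
      whereas its predecessor lies strictly below it and hence strictly below \<open>N' 0\<close>.
      What remains are \<open>i + j + 1\<close> sets, that is, \<open>i + j\<close> strict
      steps.\<close>
    define Q where "Q t = (if t < i then N t else N' (t - i))" for t
    have "strict_chain U k Q"
      unfolding strict_chain_def
    proof (intro conjI allI impI)
      fix t assume "t \<le> k"
      then show "Q t \<in> U" using N N' assms(1) k unfolding strict_chain_def Q_def by auto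
    next
      fix t assume t: "t < k"
      consider "Suc t < i" | "Suc t = i" | "i \<le> t" by linarith
      then show "Q t \<subset> Q (Suc t)"
      proof cases
        case 2
        have "N t \<subset> N i" using N 2 unfolding strict_chain_def by auto
        moreover have "N i \<subseteq> N' 0" using N N' unfolding strict_chain_def by (intro assms(2)) auto
        ultimately show ?thesis using 2 unfolding Q_def by auto
      qed (use N N' k t in \<open>auto simp: strict_chain_def Q_def Suc_diff_le\<close>)
    qed
    then show "enat k \<le> chain_length U" by (rule strict_chain_le_chain_length)
  qed
qed

text \<open>The order is reversed, larger indices lying lower, because the tails of the filtration
  shrink as the index grows. In the induction the layer of the new, largest index is put below the
  union of all the others.\<close>

lemma sum_chain_length_le:
  fixes T :: "nat \<Rightarrow> 'a set set"
  assumes "\<And>i. i \<in> {1..n} \<Longrightarrow> T i \<subseteq> U"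
    and "\<And>i j X Y. \<lbrakk> i \<in> {1..n}; j \<in> {1..n}; i < j; X \<in> T j; Y \<in> T i \<rbrakk> \<Longrightarrow> X \<subseteq> Y"
  shows "(\<Sum>i=1..n. chain_length (T i)) \<le> chain_length U"
  using assms
proof (induction n arbitrary: U)
  case (Suc n)
  have "(\<Sum>i=1..n. chain_length (T i)) \<le> chain_length (\<Union>i\<in>{1..n}. T i)"
  proof (rule Suc.IH)
    show "T i \<subseteq> (\<Union>i\<in>{1..n}. T i)" if "i \<in> {1..n}" for i using that by blast
    show "X \<subseteq> Y" if "i \<in> {1..n}" "j \<in> {1..n}" "i < j" "X \<in> T j" "Y \<in> T i" for i j X Y
      using Suc.prems(2)[of i j X Y] that by simp
  qed
  moreover have "chain_length (T (Suc n)) + chain_length (\<Union>i\<in>{1..n}. T i) \<le> chain_length U"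
    using Suc.prems(1) Suc.prems(2)[of _ "Suc n"] by (intro chain_length_superadd) fastforce+
  ultimately show ?case by (simp add: add.commute) (meson add_left_mono order_trans)
qed simp

text \<open>Deleting repetitions from a weakly increasing sequence leaves a strict chain with one
  step for each change.\<close>

lemma card_strict_steps_le:
  assumes "\<And>t. t \<le> k \<Longrightarrow> G t \<in> S" "\<And>t. t < k \<Longrightarrow> G t \<subseteq> G (Suc t)"
  shows "enat (card {t. t < k \<and> G t \<noteq> G (Suc t)}) \<le> chain_length S"
proof -
  \<comment> \<open>The claim also records that the chain ends in \<open>G k\<close>; otherwise the
    next set could not be appended.\<close>
  have "\<exists>N. strict_chain S (card {t. t < k \<and> G t \<noteq> G (Suc t)}) N \<and>
      N (card {t. t < k \<and> G t \<noteq> G (Suc t)}) = G k"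
    using assms
  proof (induction k)
    case 0
    then show ?case by (intro exI[of _ G]) (simp add: strict_chain_def)
  next
    case (Suc k)
    let ?c = "card {t. t < k \<and> G t \<noteq> G (Suc t)}"
    obtain N where N: "strict_chain S ?c N" "N ?c = G k"
      using Suc by (meson le_SucI less_SucI)
    have set: "{t. t < Suc k \<and> G t \<noteq> G (Suc t)} =
        (if G k \<noteq> G (Suc k) then insert k else id) {t. t < k \<and> G t \<noteq> G (Suc t)}"
      by (auto simp: less_Suc_eq)
    show ?case
    proof (cases "G k = G (Suc k)")
      case True
      then show ?thesis using N set by auto
    next
      case False
      then have c: "card {t. t < Suc k \<and> G t \<noteq> G (Suc t)} = Suc ?c" using set by simp
      have "G k \<subset> G (Suc k)" using Suc.prems(2)[of k] False by auto
      then have "strict_chain S (Suc ?c) (N(Suc ?c := G (Suc k)))"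
        using N Suc.prems(1)[of "Suc k"] unfolding strict_chain_def
        by (auto simp: le_Suc_eq less_Suc_eq)
      then show ?thesis unfolding c using fun_upd_same[of N "Suc ?c"] by blast
    qed
  qed
  then show ?thesis using strict_chain_le_chain_length by blast
qed

text \<open>Every step of a chain is strict in at least one coordinate, and coordinate
  \<open>i\<close> sees at most \<open>chain_length (T i)\<close> strict steps. It serves both for
  the graded parts of a submodule and for the pair formed by intersection and sum with a fixed
  submodule.\<close>

lemma chain_length_le_sum:
  assumes "finite I" "\<And>i X. \<lbrakk> i \<in> I; X \<in> S \<rbrakk> \<Longrightarrow> f i X \<in> T i"
    and "\<And>i X Y. \<lbrakk> i \<in> I; X \<in> S; Y \<in> S; X \<subset> Y \<rbrakk> \<Longrightarrow> f i X \<subseteq> f i Y"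
    and "\<And>X Y. \<lbrakk> X \<in> S; Y \<in> S; X \<subset> Y \<rbrakk> \<Longrightarrow> \<exists>i\<in>I. f i X \<noteq> f i Y"
  shows "chain_length S \<le> (\<Sum>i\<in>I. chain_length (T i))"
proof (rule chain_length_le)
  fix k N assume N: "strict_chain S k N"
  let ?J = "\<lambda>i. {t. t < k \<and> f i (N t) \<noteq> f i (N (Suc t))}"
  have "{..<k} \<subseteq> (\<Union>i\<in>I. ?J i)"
    using N assms(4) unfolding strict_chain_def by fastforce
  then have "k \<le> card (\<Union>i\<in>I. ?J i)"
    using card_mono[of "\<Union>i\<in>I. ?J i" "{..<k}"] assms(1) by auto
  also have "\<dots> \<le> (\<Sum>i\<in>I. card (?J i))" by (rule card_UN_le[OF assms(1)])
  finally have "enat k \<le> enat (\<Sum>i\<in>I. card (?J i))" by simp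
  also have "\<dots> = (\<Sum>i\<in>I. enat (card (?J i)))"
    by (simp only: of_nat_eq_enat[symmetric] of_nat_sum)
  also have "\<dots> \<le> (\<Sum>i\<in>I. chain_length (T i))"
  proof (rule sum_mono)
    fix i assume "i \<in> I"
    then show "enat (card (?J i)) \<le> chain_length (T i)"
      using N assms(2,3) unfolding strict_chain_def
      by (intro card_strict_steps_le[of k "\<lambda>t. f i (N t)"]) auto
  qed
  finally show "enat k \<le> (\<Sum>i\<in>I. chain_length (T i))" .
qed

lemma sum_enat_less_infinity_iff:
  fixes f :: "'a \<Rightarrow> enat"
  assumes "finite I"
  shows "(\<Sum>i\<in>I. f i) < \<infinity> \<longleftrightarrow> (\<forall>i\<in>I. f i < \<infinity>)"
  using assms by induction (auto simp: plus_eq_infty_iff_enat)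

section \<open>Submodules and quotient modules\<close>

context left_module
begin

lemma add_idem_imp_zero: "\<lbrakk> z \<in> carrier M; z \<oplus>\<^bsub>M\<^esub> z = z \<rbrakk> \<Longrightarrow> z = \<zero>\<^bsub>M\<^esub>"
  by simp

lemma smult_zero_left [simp]:
  assumes "x \<in> carrier M"
  shows "\<zero>\<^bsub>R\<^esub> \<odot>\<^bsub>M\<^esub> x = \<zero>\<^bsub>M\<^esub>"
proof -
  have "\<zero>\<^bsub>R\<^esub> \<odot>\<^bsub>M\<^esub> x \<oplus>\<^bsub>M\<^esub> \<zero>\<^bsub>R\<^esub> \<odot>\<^bsub>M\<^esub> x = \<zero>\<^bsub>R\<^esub> \<odot>\<^bsub>M\<^esub> x"
    using assms smult_l_distr[of "\<zero>\<^bsub>R\<^esub>" "\<zero>\<^bsub>R\<^esub>" x, symmetric] by simp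
  then show ?thesis using assms by (intro add_idem_imp_zero) simp_all
qed

lemma smult_zero_right [simp]:
  assumes "r \<in> carrier R"
  shows "r \<odot>\<^bsub>M\<^esub> \<zero>\<^bsub>M\<^esub> = \<zero>\<^bsub>M\<^esub>"
proof -
  have "r \<odot>\<^bsub>M\<^esub> \<zero>\<^bsub>M\<^esub> \<oplus>\<^bsub>M\<^esub> r \<odot>\<^bsub>M\<^esub> \<zero>\<^bsub>M\<^esub> = r \<odot>\<^bsub>M\<^esub> \<zero>\<^bsub>M\<^esub>"
    using assms smult_r_distr[of r "\<zero>\<^bsub>M\<^esub>" "\<zero>\<^bsub>M\<^esub>", symmetric] by simp
  then show ?thesis using assms by (intro add_idem_imp_zero) simp_all
qed

lemma smult_minus_one:
  assumes "x \<in> carrier M"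
  shows "(\<ominus>\<^bsub>R\<^esub> \<one>\<^bsub>R\<^esub>) \<odot>\<^bsub>M\<^esub> x = \<ominus>\<^bsub>M\<^esub> x"
proof -
  have "(\<ominus>\<^bsub>R\<^esub> \<one>\<^bsub>R\<^esub>) \<odot>\<^bsub>M\<^esub> x \<oplus>\<^bsub>M\<^esub> x = \<zero>\<^bsub>M\<^esub>"
    using assms smult_l_distr[of "\<ominus>\<^bsub>R\<^esub> \<one>\<^bsub>R\<^esub>" "\<one>\<^bsub>R\<^esub>" x] by (simp add: R.l_neg)
  then show ?thesis using assms by (simp add: M.minus_equality)
qed

lemma submoduleI:
  assumes "X \<subseteq> carrier M" "\<zero>\<^bsub>M\<^esub> \<in> X"
    and "\<And>x y. \<lbrakk> x \<in> X; y \<in> X \<rbrakk> \<Longrightarrow> x \<oplus>\<^bsub>M\<^esub> y \<in> X"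
    and "\<And>r x. \<lbrakk> r \<in> carrier R; x \<in> X \<rbrakk> \<Longrightarrow> r \<odot>\<^bsub>M\<^esub> x \<in> X"
  shows "submodule X R M"
proof -
  have "\<ominus>\<^bsub>M\<^esub> x \<in> X" if "x \<in> X" for x
    using that assms(1) assms(4)[of "\<ominus>\<^bsub>R\<^esub> \<one>\<^bsub>R\<^esub>" x] smult_minus_one[of x] by auto
  then show ?thesis
    by (intro submodule.intro subgroup.intro submodule_axioms.intro) (use assms in \<open>auto simp: a_inv_def\<close>)
qed

lemma submoduleD:
  assumes "submodule X R M"
  shows "X \<subseteq> carrier M" "\<zero>\<^bsub>M\<^esub> \<in> X"
    and "\<And>x y. \<lbrakk> x \<in> X; y \<in> X \<rbrakk> \<Longrightarrow> x \<oplus>\<^bsub>M\<^esub> y \<in> X"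
    and "\<And>r x. \<lbrakk> r \<in> carrier R; x \<in> X \<rbrakk> \<Longrightarrow> r \<odot>\<^bsub>M\<^esub> x \<in> X"
    and "\<And>x. x \<in> X \<Longrightarrow> \<ominus>\<^bsub>M\<^esub> x \<in> X"
    and "\<And>x y. \<lbrakk> x \<in> X; y \<in> X \<rbrakk> \<Longrightarrow> x \<ominus>\<^bsub>M\<^esub> y \<in> X"
proof -
  have X: "subgroup X (add_monoid M)" using assms by (simp add: submodule_def)
  show "X \<subseteq> carrier M" "\<zero>\<^bsub>M\<^esub> \<in> X"
    using subgroup.subset[OF X] subgroup.one_closed[OF X] by simp_all
  show add: "x \<oplus>\<^bsub>M\<^esub> y \<in> X" if "x \<in> X" "y \<in> X" for x y
    using subgroup.m_closed[OF X that] by simp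
  show "r \<odot>\<^bsub>M\<^esub> x \<in> X" if "r \<in> carrier R" "x \<in> X" for r x
    using assms that by (rule submodule.smult_closed)
  show inv: "\<ominus>\<^bsub>M\<^esub> x \<in> X" if "x \<in> X" for x
    unfolding a_inv_def using X that by (rule subgroup.m_inv_closed)
  show "x \<ominus>\<^bsub>M\<^esub> y \<in> X" if "x \<in> X" "y \<in> X" for x y
    unfolding a_minus_def using that by (intro add inv)
qed

lemma submodule_carrier: "submodule (carrier M) R M"
  by (rule submoduleI) auto

lemma submodule_zero: "submodule {\<zero>\<^bsub>M\<^esub>} R M"
  by (rule submoduleI) auto

lemma submodule_Int:
  assumes "submodule X R M" "submodule Y R M"
  shows "submodule (X \<inter> Y) R M"
  using submoduleD[OF assms(1)] submoduleD[OF assms(2)] by (intro submoduleI) auto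

lemma set_addI: "\<lbrakk> x \<in> X; y \<in> Y \<rbrakk> \<Longrightarrow> x \<oplus>\<^bsub>M\<^esub> y \<in> X <+>\<^bsub>M\<^esub> Y"
  by (auto simp: set_add_def')

lemma set_addE:
  assumes "z \<in> X <+>\<^bsub>M\<^esub> Y"
  obtains x y where "x \<in> X" "y \<in> Y" "z = x \<oplus>\<^bsub>M\<^esub> y"
  using assms by (auto simp: set_add_def')

lemma submodule_set_add:
  assumes "submodule X R M" "submodule Y R M"
  shows "submodule (X <+>\<^bsub>M\<^esub> Y) R M" "X \<subseteq> X <+>\<^bsub>M\<^esub> Y" "Y \<subseteq> X <+>\<^bsub>M\<^esub> Y"
proof -
  note X = submoduleD[OF assms(1)] and Y = submoduleD[OF assms(2)]
  show sub: "X \<subseteq> X <+>\<^bsub>M\<^esub> Y"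
  proof
    fix x assume x: "x \<in> X"
    then show "x \<in> X <+>\<^bsub>M\<^esub> Y"
      using set_addI[OF x Y(2)] M.r_zero[of x] X(1) by (metis subsetD)
  qed
  show "Y \<subseteq> X <+>\<^bsub>M\<^esub> Y"
  proof
    fix y assume y: "y \<in> Y"
    then show "y \<in> X <+>\<^bsub>M\<^esub> Y"
      using set_addI[OF X(2) y] M.l_zero[of y] Y(1) by (metis subsetD)
  qed
  show "submodule (X <+>\<^bsub>M\<^esub> Y) R M"
  proof (rule submoduleI)
    show "X <+>\<^bsub>M\<^esub> Y \<subseteq> carrier M" using X(1) Y(1) by (rule M.setadd_subset_G)
    show "\<zero>\<^bsub>M\<^esub> \<in> X <+>\<^bsub>M\<^esub> Y" using sub X(2) by (rule subsetD)
  next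
    fix a b assume "a \<in> X <+>\<^bsub>M\<^esub> Y" "b \<in> X <+>\<^bsub>M\<^esub> Y"
    then obtain x y x' y' where *: "x \<in> X" "y \<in> Y" "x' \<in> X" "y' \<in> Y"
        "a = x \<oplus>\<^bsub>M\<^esub> y" "b = x' \<oplus>\<^bsub>M\<^esub> y'" by (elim set_addE)
    moreover have "x \<in> carrier M" "y \<in> carrier M" "x' \<in> carrier M" "y' \<in> carrier M"
      using * X(1) Y(1) by (simp_all add: subsetD)
    ultimately have "a \<oplus>\<^bsub>M\<^esub> b = (x \<oplus>\<^bsub>M\<^esub> x') \<oplus>\<^bsub>M\<^esub> (y \<oplus>\<^bsub>M\<^esub> y')"
      by (simp add: M.a_ac)
    then show "a \<oplus>\<^bsub>M\<^esub> b \<in> X <+>\<^bsub>M\<^esub> Y" using * X(3) Y(3) by (simp add: set_addI)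
  next
    fix r a assume r: "r \<in> carrier R" and "a \<in> X <+>\<^bsub>M\<^esub> Y"
    then obtain x y where *: "x \<in> X" "y \<in> Y" "a = x \<oplus>\<^bsub>M\<^esub> y" by (elim set_addE)
    moreover have "x \<in> carrier M" "y \<in> carrier M"
      using * X(1) Y(1) by (simp_all add: subsetD)
    ultimately have "r \<odot>\<^bsub>M\<^esub> a = r \<odot>\<^bsub>M\<^esub> x \<oplus>\<^bsub>M\<^esub> r \<odot>\<^bsub>M\<^esub> y"
      using r by (simp add: smult_r_distr)
    then show "r \<odot>\<^bsub>M\<^esub> a \<in> X <+>\<^bsub>M\<^esub> Y" using * r X(4) Y(4) by (simp add: set_addI)
  qed
qed

lemma set_add_mono: "\<lbrakk> X \<subseteq> X'; Y \<subseteq> Y' \<rbrakk> \<Longrightarrow> X <+>\<^bsub>M\<^esub> Y \<subseteq> X' <+>\<^bsub>M\<^esub> Y'"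
  by (auto simp: set_add_def')

lemma set_add_subset_submodule:
  assumes "submodule Z R M" "X \<subseteq> Z" "Y \<subseteq> Z"
  shows "X <+>\<^bsub>M\<^esub> Y \<subseteq> Z"
  using submoduleD(3)[OF assms(1)] assms(2,3) by (auto simp: set_add_def')

lemma submodule_cyclic:
  assumes "x \<in> carrier M"
  shows "submodule (cyclic_submodule R M x) R M" "x \<in> cyclic_submodule R M x"
proof -
  show "submodule (cyclic_submodule R M x) R M"
  proof (rule submoduleI)
    show "\<zero>\<^bsub>M\<^esub> \<in> cyclic_submodule R M x"
      unfolding cyclic_submodule_def using assms smult_zero_left[of x] by force
  next
    fix a b assume "a \<in> cyclic_submodule R M x" "b \<in> cyclic_submodule R M x"
    then obtain r s where "r \<in> carrier R" "s \<in> carrier R" "a = r \<odot>\<^bsub>M\<^esub> x" "b = s \<odot>\<^bsub>M\<^esub> x"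
      unfolding cyclic_submodule_def by blast
    then show "a \<oplus>\<^bsub>M\<^esub> b \<in> cyclic_submodule R M x"
      unfolding cyclic_submodule_def using assms smult_l_distr[of r s x] by (auto intro!: exI[of _ "r \<oplus>\<^bsub>R\<^esub> s"])
  next
    fix r a assume "r \<in> carrier R" "a \<in> cyclic_submodule R M x"
    then obtain s where "r \<in> carrier R" "s \<in> carrier R" "a = s \<odot>\<^bsub>M\<^esub> x"
      unfolding cyclic_submodule_def by blast
    then show "r \<odot>\<^bsub>M\<^esub> a \<in> cyclic_submodule R M x"
      unfolding cyclic_submodule_def using assms smult_assoc1[of r s x] by (auto intro!: exI[of _ "r \<otimes>\<^bsub>R\<^esub> s"])
  qed (use assms in \<open>auto simp: cyclic_submodule_def\<close>)
  show "x \<in> cyclic_submodule R M x"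
    unfolding cyclic_submodule_def using assms smult_one[of x] by force
qed

lemma cyclic_submodule_subset:
  assumes "submodule X R M" "x \<in> X"
  shows "cyclic_submodule R M x \<subseteq> X"
  using submoduleD(4)[OF assms(1)] assms(2) by (auto simp: cyclic_submodule_def)

text \<open>Two comparable submodules with the same intersection and the same sum with
  \<open>G\<close> are equal, by the modular law. The two values of \<open>b\<close> index these two
  coordinates.\<close>

lemma chain_length_subadd:
  assumes "submodule G R M"
  shows "chain_length {X. submodule X R M} \<le>
    chain_length {X. submodule X R M \<and> X \<subseteq> G} + chain_length {X. submodule X R M \<and> G \<subseteq> X}"
proof -
  let ?f = "\<lambda>b X. if b then X \<inter> G else G <+>\<^bsub>M\<^esub> X"
  let ?T = "\<lambda>b. if b then {X. submodule X R M \<and> X \<subseteq> G} else {X. submodule X R M \<and> G \<subseteq> X}"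
  have "chain_length {X. submodule X R M} \<le> (\<Sum>b\<in>UNIV. chain_length (?T b))"
  proof (rule chain_length_le_sum[where f = ?f])
    fix X Y assume "X \<in> {X. submodule X R M}" "Y \<in> {X. submodule X R M}" and "X \<subset> Y"
    then have X: "submodule X R M" and Y: "submodule Y R M" and XY: "X \<subseteq> Y" and "X \<noteq> Y" by auto
    then obtain y where y: "y \<in> Y" "y \<notin> X" by blast
    show "\<exists>b\<in>UNIV. ?f b X \<noteq> ?f b Y"
    proof (rule ccontr)
      assume "\<not> ?thesis"
      then have *: "?f b X = ?f b Y" for b by blast
      have 1: "X \<inter> G = Y \<inter> G" and 2: "G <+>\<^bsub>M\<^esub> X = G <+>\<^bsub>M\<^esub> Y"
        using *[of True] *[of False] by simp_all
      have "y \<in> G <+>\<^bsub>M\<^esub> X" using 2 y submodule_set_add(3)[OF assms Y] by auto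
      then obtain g x where *: "g \<in> G" "x \<in> X" "y = g \<oplus>\<^bsub>M\<^esub> x" by (rule set_addE)
      have "g \<in> carrier M" "x \<in> carrier M"
        using * submoduleD(1)[OF assms] submoduleD(1)[OF X] by (simp_all add: subsetD)
      \<comment> \<open>Both \<open>y\<close> and \<open>x\<close> lie in \<open>Y\<close>, so their
        difference lies in the intersection of \<open>Y\<close> with \<open>G\<close>, which is that
        of \<open>X\<close> with \<open>G\<close>; this forces \<open>y\<close> into
        \<open>X\<close>.\<close>
      then have "g = y \<ominus>\<^bsub>M\<^esub> x"
        using * by (simp add: a_minus_def M.a_assoc M.r_neg)
      moreover have "x \<in> Y" using XY *(2) by (rule subsetD)
      ultimately have "g \<in> Y" using submoduleD(6)[OF Y y(1)] by simp
      then have "g \<in> X" using *(1) 1 by blast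
      then have "y \<in> X" unfolding *(3) using *(2) by (rule submoduleD(3)[OF X])
      then show False using y by simp
    qed
  next
    fix b :: bool and X assume "X \<in> {X. submodule X R M}"
    then have "submodule X R M" by simp
    then show "?f b X \<in> ?T b"
      using assms submodule_Int[of X G] submodule_set_add[of G X] by (cases b) simp_all
  next
    fix b :: bool and X Y :: "'c set" assume "X \<subset> Y"
    then show "?f b X \<subseteq> ?f b Y" using set_add_mono[of G G X Y] by (cases b) auto
  qed simp
  then show ?thesis unfolding UNIV_bool by (subst (asm) sum.insert) (simp_all add: add.commute)
qed

end

section \<open>Submodules and quotients: their lengths as lengths of intervals\<close>

lemma (in left_module) submodule_submodule_as_module_iff:
  assumes "submodule N R M"
  shows "submodule X R (submodule_as_module M N) \<longleftrightarrow> submodule X R M \<and> X \<subseteq> N"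
proof -
  have N: "subgroup N (add_monoid M)" using assms by (simp add: submodule_def)
  have "add_monoid (submodule_as_module M N) = (add_monoid M)\<lparr>carrier := N\<rparr>"
    by (simp add: submodule_as_module_def)
  moreover have "subgroup X ((add_monoid M)\<lparr>carrier := N\<rparr>) \<longleftrightarrow> subgroup X (add_monoid M) \<and> X \<subseteq> N"
    using M.add.incl_subgroup[OF N, of X] M.add.subgroup_incl[OF _ N, of X] subgroup.subset[of X "(add_monoid M)\<lparr>carrier := N\<rparr>"] by auto
  ultimately show ?thesis
    by (auto simp: submodule_def submodule_axioms_def submodule_as_module_def)
qed

lemma (in left_module) module_length_submodule_as_module:
  assumes "submodule N R M"
  shows "module_length R (submodule_as_module M N) = chain_length {X. submodule X R M \<and> X \<subseteq> N}"
  by (simp add: module_length_eq submodule_submodule_as_module_iff[OF assms])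

context left_module
begin

lemma a_r_coset_iff: "y \<in> N +>\<^bsub>M\<^esub> x \<longleftrightarrow> (\<exists>h\<in>N. y = h \<oplus>\<^bsub>M\<^esub> x)"
  by (simp add: a_r_coset_def')

text \<open>The scalar action is defined as a union over all representatives. Changing the
  representative by h in \<open>N\<close> changes the product by rh in \<open>N\<close>, so all
  members of the union are the same coset.\<close>

lemma quotient_smult:
  assumes "submodule N R M" "x \<in> carrier M" "r \<in> carrier R"
  shows "r \<odot>\<^bsub>quotient_module M N\<^esub> (N +>\<^bsub>M\<^esub> x) = N +>\<^bsub>M\<^esub> (r \<odot>\<^bsub>M\<^esub> x)"
proof -
  note N = submoduleD[OF assms(1)]
  have sub: "subgroup N (add_monoid M)" using assms(1) by (simp add: submodule_def)
  have self: "x \<in> N +>\<^bsub>M\<^esub> x"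
    unfolding a_r_coset_iff using N(2) M.l_zero[OF assms(2)] by (intro bexI) simp_all
  have eq: "N +>\<^bsub>M\<^esub> (r \<odot>\<^bsub>M\<^esub> y) = N +>\<^bsub>M\<^esub> (r \<odot>\<^bsub>M\<^esub> x)" if y: "y \<in> N +>\<^bsub>M\<^esub> x" for y
  proof -
    obtain h where h: "h \<in> N" "y = h \<oplus>\<^bsub>M\<^esub> x" using y unfolding a_r_coset_iff by (rule bexE)
    moreover have "h \<in> carrier M" using h(1) N(1) by (rule subsetD[rotated])
    ultimately have "r \<odot>\<^bsub>M\<^esub> y = r \<odot>\<^bsub>M\<^esub> h \<oplus>\<^bsub>M\<^esub> r \<odot>\<^bsub>M\<^esub> x"
      using assms(2,3) by (simp add: smult_r_distr)
    then have "r \<odot>\<^bsub>M\<^esub> y \<in> N +>\<^bsub>M\<^esub> (r \<odot>\<^bsub>M\<^esub> x)"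
      unfolding a_r_coset_iff using N(4)[OF assms(3) h(1)] by (rule bexI)
    then show ?thesis
      using assms(2,3) sub by (intro M.a_repr_independence[symmetric]) simp_all
  qed
  have "(\<Union>y\<in>N +>\<^bsub>M\<^esub> x. N +>\<^bsub>M\<^esub> (r \<odot>\<^bsub>M\<^esub> y)) = N +>\<^bsub>M\<^esub> (r \<odot>\<^bsub>M\<^esub> x)"
    using self eq by blast
  then show ?thesis by (simp add: quotient_module_def)
qed

text \<open>The correspondence theorem: taking preimages and taking images under the projection are
  both strictly monotone, which gives one inequality each.\<close>

lemma module_length_quotient_module:
  assumes "submodule N R M"
  shows "module_length R (quotient_module M N) = chain_length {X. submodule X R M \<and> N \<subseteq> X}"
proof -
  let ?Q = "quotient_module M N"
  note N = submoduleD[OF assms]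
  have sub: "subgroup N (add_monoid M)" using assms by (simp add: submodule_def)
  interpret N: abelian_subgroup N M
    by (rule abelian_subgroupI3) (use sub M.abelian_group_axioms in \<open>auto intro: additive_subgroup.intro\<close>)
  \<comment> \<open>Both groups have the same carrier, addition and zero, so the facts on
    \<open>M A_Mod N\<close> apply to the quotient module.\<close>
  have addQ: "subgroup Y (add_monoid ?Q) \<longleftrightarrow> subgroup Y (M A_Mod N)" for Y
    by (simp add: quotient_module_def A_FactGroup_def' subgroup_def m_inv_def)
  have subQ: "submodule Y R ?Q \<longleftrightarrow> subgroup Y (M A_Mod N) \<and>
      (\<forall>r\<in>carrier R. \<forall>y\<in>Y. r \<odot>\<^bsub>?Q\<^esub> y \<in> Y)" for Y
    unfolding submodule_def submodule_axioms_def addQ by blast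
  have carr: "carrier (M A_Mod N) = (\<lambda>x. N +>\<^bsub>M\<^esub> x) ` carrier M"
    by (auto simp: A_FactGroup_def' A_RCOSETS_def')
  have coset_N: "N +>\<^bsub>M\<^esub> x = N" if "x \<in> N" for x
    using that sub N(1) by (intro M.a_coset_join2) auto
  \<comment> \<open>A submodule containing \<open>N\<close> is a union of cosets; hence an element
    outside it has its coset outside the image.\<close>
  have mem: "x \<in> X" if "x \<in> carrier M" "submodule X R M" "N \<subseteq> X" "y \<in> X" "N +>\<^bsub>M\<^esub> x = N +>\<^bsub>M\<^esub> y" for x y X
  proof -
    have "x \<in> N +>\<^bsub>M\<^esub> y" using N.a_rcos_self[OF that(1)] that(5) by simp
    then obtain h where "h \<in> N" "x = h \<oplus>\<^bsub>M\<^esub> y" unfolding a_r_coset_iff by (rule bexE)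
    then show ?thesis using submoduleD(3)[OF that(2) _ that(4)] that(3) by (simp add: subsetD)
  qed
  let ?f = "\<lambda>Y. {x \<in> carrier M. N +>\<^bsub>M\<^esub> x \<in> Y}"
  let ?g = "\<lambda>X. (\<lambda>x. N +>\<^bsub>M\<^esub> x) ` X"
  have "chain_length {Y. submodule Y R ?Q} \<le> chain_length {X. submodule X R M \<and> N \<subseteq> X}"
  proof (rule chain_length_map_le[where f = ?f])
    have "submodule (?f Y) R M \<and> N \<subseteq> ?f Y" if Y: "submodule Y R ?Q" for Y
    proof -
      have sg: "subgroup Y (M A_Mod N)" using Y by (simp add: subQ)
      have NY: "N \<in> Y" using subgroup.one_closed[OF sg] by (simp add: A_FactGroup_def')
      have add: "N +>\<^bsub>M\<^esub> (x \<oplus>\<^bsub>M\<^esub> y) \<in> Y"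
        if "x \<in> carrier M" "y \<in> carrier M" "N +>\<^bsub>M\<^esub> x \<in> Y" "N +>\<^bsub>M\<^esub> y \<in> Y" for x y
        using subgroup.m_closed[OF sg that(3,4)] that(1,2) N.a_rcos_sum by simp
      have smult: "N +>\<^bsub>M\<^esub> (r \<odot>\<^bsub>M\<^esub> x) \<in> Y"
        if "r \<in> carrier R" "x \<in> carrier M" "N +>\<^bsub>M\<^esub> x \<in> Y" for r x
        using Y that quotient_smult[OF assms that(2,1)] unfolding subQ by metis
      have "submodule {x \<in> carrier M. N +>\<^bsub>M\<^esub> x \<in> Y} R M"
        using add smult NY coset_N[OF N(2)] by (intro submoduleI) auto
      moreover have "N \<subseteq> ?f Y" using N(1) NY coset_N by auto
      ultimately show ?thesis by blast
    qed
    then show "?f ` {Y. submodule Y R ?Q} \<subseteq> {X. submodule X R M \<and> N \<subseteq> X}" by blast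
  next
    fix X Y assume "X \<in> {Y. submodule Y R ?Q}" "Y \<in> {Y. submodule Y R ?Q}" and XY: "X \<subset> Y"
    \<comment> \<open>Each member of \<open>Y\<close> is the coset of some element, so a coset in
      \<open>Y\<close> but not in \<open>X\<close> has a representative that separates the
      preimages.\<close>
    then have "Y \<subseteq> ?g (carrier M)"
      using subgroup.subset[of Y "M A_Mod N"] carr by (auto simp: subQ)
    then have "?f X \<noteq> ?f Y" using XY by blast
    then show "?f X \<subset> ?f Y" using XY by blast
  qed
  moreover have "chain_length {X. submodule X R M \<and> N \<subseteq> X} \<le> chain_length {Y. submodule Y R ?Q}"
  proof (rule chain_length_map_le[where f = ?g])
    have "submodule (?g X) R ?Q" if X: "submodule X R M" "N \<subseteq> X" for X
    proof -
      note XD = submoduleD[OF X(1)]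
      have "subgroup (?g X) (M A_Mod N)"
      proof (rule subgroup.intro)
        show "?g X \<subseteq> carrier (M A_Mod N)" using XD(1) carr by auto
        show "\<one>\<^bsub>M A_Mod N\<^esub> \<in> ?g X"
          using coset_N[OF N(2)] XD(2) by (force simp: A_FactGroup_def')
      next
        fix a b assume "a \<in> ?g X" "b \<in> ?g X"
        then obtain x y where "x \<in> X" "y \<in> X" "a = N +>\<^bsub>M\<^esub> x" "b = N +>\<^bsub>M\<^esub> y" by blast
        then show "a \<otimes>\<^bsub>M A_Mod N\<^esub> b \<in> ?g X"
          using XD(1,3) by (auto simp: N.a_rcos_sum subset_iff)
      next
        fix a assume "a \<in> ?g X"
        then obtain x where x: "x \<in> X" "x \<in> carrier M" "a = N +>\<^bsub>M\<^esub> x" using XD(1) by blast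
        then have "inv\<^bsub>M A_Mod N\<^esub> a = N +>\<^bsub>M\<^esub> (\<ominus>\<^bsub>M\<^esub> x)"
          using N.a_inv_FactGroup[of a] carr by (simp add: N.a_rcos_inv)
        then show "inv\<^bsub>M A_Mod N\<^esub> a \<in> ?g X"
          using XD(5) x by auto
      qed
      then show ?thesis
        unfolding subQ using XD(1,4) quotient_smult[OF assms] by auto
    qed
    then show "?g ` {X. submodule X R M \<and> N \<subseteq> X} \<subseteq> {Y. submodule Y R ?Q}" by blast
  next
    fix X Y
    assume "X \<in> {X. submodule X R M \<and> N \<subseteq> X}" "Y \<in> {X. submodule X R M \<and> N \<subseteq> X}" and XY: "X \<subset> Y"
    then have X: "submodule X R M" "N \<subseteq> X" and Y: "Y \<subseteq> carrier M" using submoduleD(1) by auto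
    obtain y where y: "y \<in> Y" "y \<notin> X" using XY by blast
    then have "N +>\<^bsub>M\<^esub> y \<notin> ?g X" using mem[OF _ X] Y by blast
    then show "?g X \<subset> ?g Y" using XY y by blast
  qed
  ultimately show ?thesis unfolding module_length_eq by (rule antisym)
qed

end

section \<open>Euclidean modules\<close>

context l_finite_euclidean_module
begin

text \<open>Division of an element of \<open>N\<close> by \<open>x\<close> leaves a remainder that
  again lies in \<open>N\<close>; a nonzero one would have degree below the least.\<close>

lemma least_degree_generates:
  assumes "submodule N R E" "least_degree_in E P d N x"
  shows "N = cyclic_submodule R E x"
proof
  note N = submoduleD[OF assms(1)]
  have x: "x \<in> N" "x \<noteq> \<zero>\<^bsub>E\<^esub>" "x \<in> carrier E" and least: "\<And>y. \<lbrakk> y \<in> N; y \<noteq> \<zero>\<^bsub>E\<^esub> \<rbrakk> \<Longrightarrow> d x \<sqsubseteq>\<^bsub>P\<^esub> d y"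
    using assms(2) N(1) by (auto simp: least_degree_in_def)
  show "cyclic_submodule R E x \<subseteq> N" by (rule cyclic_submodule_subset[OF assms(1) x(1)])
  show "N \<subseteq> cyclic_submodule R E x"
  proof
    fix u assume u: "u \<in> N"
    show "u \<in> cyclic_submodule R E x"
    proof (cases "u = \<zero>\<^bsub>E\<^esub>")
      case True
      then show ?thesis using submoduleD(2)[OF submodule_cyclic(1)[OF x(3)]] by simp
    next
      case False
      then obtain q r where qr: "q \<in> carrier R" "r \<in> carrier E" "u = q \<odot>\<^bsub>E\<^esub> x \<oplus>\<^bsub>E\<^esub> r"
          "r = \<zero>\<^bsub>E\<^esub> \<or> d r \<sqsubset>\<^bsub>P\<^esub> d x"
        using division[of u x] u x N(1) by blast
      have "r = \<ominus>\<^bsub>E\<^esub> (q \<odot>\<^bsub>E\<^esub> x) \<oplus>\<^bsub>E\<^esub> u"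
        using qr x by (simp add: M.r_neg1)
      then have "r \<in> N" using N(3,4,5) qr(1) x u by metis
      have "r = \<zero>\<^bsub>E\<^esub>"
      proof (rule ccontr)
        assume r: "r \<noteq> \<zero>\<^bsub>E\<^esub>"
        then have "d r \<sqsubset>\<^bsub>P\<^esub> d x" "d x \<sqsubseteq>\<^bsub>P\<^esub> d r" using qr(4) least \<open>r \<in> N\<close> by auto
        moreover have "d r \<in> carrier P" "d x \<in> carrier P"
          using degree_closed r qr(2) x by auto
        ultimately show False unfolding lless_def by (auto simp: eq_is_equal)
      qed
      then show ?thesis using qr x by (auto simp: cyclic_submodule_def)
    qed
  qed
qed

text \<open>If the two degrees agreed, \<open>x\<close> would have least degree in \<open>Y\<close>
  as well, hence generate \<open>Y\<close>, although it lies in the smaller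
  \<open>X\<close>.\<close>

lemma least_degree_strict:
  assumes "submodule X R E" "submodule Y R E" "X \<subset> Y"
    and x: "least_degree_in E P d X x" and y: "least_degree_in E P d Y y"
  shows "d y \<sqsubset>\<^bsub>P\<^esub> d x"
proof -
  have "x \<in> X" "x \<noteq> \<zero>\<^bsub>E\<^esub>" using x by (auto simp: least_degree_in_def)
  then have le: "d y \<sqsubseteq>\<^bsub>P\<^esub> d x" using y assms(3) by (auto simp: least_degree_in_def)
  have "d y \<noteq> d x"
  proof
    assume "d y = d x"
    then have "least_degree_in E P d Y x"
      using y \<open>x \<in> X\<close> \<open>x \<noteq> \<zero>\<^bsub>E\<^esub>\<close> assms(3) by (auto simp: least_degree_in_def)
    then have "Y = cyclic_submodule R E x" by (rule least_degree_generates[OF assms(2)])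
    then show False
      using cyclic_submodule_subset[OF assms(1) \<open>x \<in> X\<close>] assms(3) by auto
  qed
  then show ?thesis using le by (simp add: lless_def eq_is_equal)
qed

text \<open>A chain with \<open>k\<close> steps, where \<open>k\<close> is positive, has
  \<open>k + 1\<close> least degrees, and they give a chain of \<open>k + 1\<close> entries from
  \<open>d g\<close> to \<open>d v\<close>. Since \<open>interval_length\<close> counts entries and
  \<open>chain_length\<close> counts steps, the interval length itself is a bound.\<close>

lemma chain_length_above_nonzero_finite:
  assumes "v \<in> carrier E" "v \<noteq> \<zero>\<^bsub>E\<^esub>"
  shows "chain_length {X. submodule X R E \<and> cyclic_submodule R E v \<subseteq> X} < \<infinity>"
proof -
  let ?S = "{X. submodule X R E \<and> cyclic_submodule R E v \<subseteq> X}"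
  let ?I = "d ` (carrier E - {\<zero>\<^bsub>E\<^esub>})"
  let ?P = "P\<lparr>carrier := ?I\<rparr>"
  have I: "?I \<subseteq> carrier P" using degree_closed by auto
  have ne: "v \<in> X" "X \<noteq> {\<zero>\<^bsub>E\<^esub>}" if "X \<in> ?S" for X
    using that submodule_cyclic(2)[OF assms(1)] assms(2) by auto
  obtain g where g: "least_degree_in E P d (carrier E) g"
    using least_degree_exists[OF submodule_carrier] assms by auto
  have gI: "d g \<in> ?I" and gle: "\<And>y. y \<in> ?I \<Longrightarrow> d g \<sqsubseteq>\<^bsub>P\<^esub> y"
    using g by (auto simp: least_degree_in_def)
  let ?L = "interval_length ?P (d g) (d v)"
  have vI: "d v \<in> ?I" using assms by auto
  have fin: "?L < \<infinity>" by (rule finite_intervals[OF gI vI gle[OF vI]])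
  have "enat k \<le> ?L" if N: "strict_chain ?S k N" for k N
  proof (cases "k = 0")
    case False
    have S: "N i \<in> ?S" if "i \<le> k" for i using N that by (auto simp: strict_chain_def)
    have "\<forall>i\<in>{..k}. \<exists>x. least_degree_in E P d (N i) x"
      using S ne(2) least_degree_exists by blast
    then obtain x where x: "\<And>i. i \<le> k \<Longrightarrow> least_degree_in E P d (N i) (x i)"
      by (metis atMost_iff)
    have xI: "d (x i) \<in> ?I" if "i \<le> k" for i
      using x[OF that] S[OF that] submoduleD(1) by (force simp: least_degree_in_def)
    have less: "d (x j) \<sqsubset>\<^bsub>P\<^esub> d (x i)" if "i < j" "j \<le> k" for i j
      using least_degree_strict[of "N i" "N j" "x i" "x j"] S x that strict_chain_less[OF N that] by simp
    \<comment> \<open>The strict relation is \<open>\<sqsubseteq>\<close> together with inequality,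
      so keeping strictness along transitivity takes antisymmetry.\<close>
    have tr: "a \<sqsubset>\<^bsub>P\<^esub> c" if "a \<sqsubseteq>\<^bsub>P\<^esub> b" "b \<sqsubset>\<^bsub>P\<^esub> c" "a \<in> ?I" "b \<in> ?I" "c \<in> ?I" for a b c
      using that I le_trans[of a b c] le_antisym[of b c] unfolding lless_def eq_is_equal by blast
    have tr': "a \<sqsubset>\<^bsub>P\<^esub> c" if "a \<sqsubset>\<^bsub>P\<^esub> b" "b \<sqsubseteq>\<^bsub>P\<^esub> c" "a \<in> ?I" "b \<in> ?I" "c \<in> ?I" for a b c
      using that I le_trans[of a b c] le_antisym[of a b] unfolding lless_def eq_is_equal by blast
    have g_less: "d g \<sqsubset>\<^bsub>P\<^esub> d (x i)" if "i < k" for i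
      using tr[OF gle less[OF that]] gI xI that by simp
    have v_ge: "d (x 0) \<sqsubseteq>\<^bsub>P\<^esub> d v"
      using x[of 0] ne(1)[OF S[of 0]] assms(2) by (simp add: least_degree_in_def)
    have less_v: "d (x i) \<sqsubset>\<^bsub>P\<^esub> d v" if "0 < i" "i \<le> k" for i
      using tr'[OF less[OF that] v_ge] vI xI that by simp
    \<comment> \<open>The pair of end points; for \<open>k = 1\<close> the list has no other
      entries. A nonzero \<open>k\<close> guarantees a strict step between them.\<close>
    have g_less_v: "d g \<sqsubset>\<^bsub>P\<^esub> d v"
      using tr'[OF g_less[of 0] v_ge] False vI gI xI by simp
    \<comment> \<open>\<open>d (x 0)\<close> and \<open>d (x k)\<close>, which may coincide with \<open>d v\<close> and \<open>d g\<close>, are replaced by them.\<close>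
    let ?c = "d g # map (\<lambda>i. d (x (k - i))) [1..<k] @ [d v]"
    \<comment> \<open>The interval is taken in the image of the degree function; restricting the
      carrier leaves the order relation as it is.\<close>
    have lless_eq: "lless ?P = lless P" by (intro ext) (simp add: lless_def)
    have "sorted_wrt (\<lambda>i j. d (x (k - i)) \<sqsubset>\<^bsub>P\<^esub> d (x (k - j))) [1..<k]"
      by (rule sorted_wrt_mono_rel[OF _ sorted_wrt_upt]) (auto intro: less)
    then have "sorted_wrt (lless ?P) ?c"
      unfolding lless_eq using g_less less_v g_less_v by (auto simp: sorted_wrt_append sorted_wrt_map)
    moreover have "set ?c \<subseteq> carrier ?P" using gI vI xI by auto
    ultimately have "enat (length ?c) \<le> ?L"
      unfolding interval_length_def by (intro Sup_upper CollectI exI[of _ ?c]) auto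
    moreover have "k \<le> length ?c" using False by simp
    ultimately show ?thesis by (meson enat_ord_simps(1) order_trans)
  qed (simp add: zero_enat_def[symmetric])
  then have "chain_length ?S \<le> ?L" by (rule chain_length_le)
  then show ?thesis using fin by (rule le_less_trans)
qed

end

section \<open>Row modules\<close>

context left_module
begin

lemma finsum_smult:
  assumes "finite I" "r \<in> carrier R" "f \<in> I \<rightarrow> carrier M"
  shows "r \<odot>\<^bsub>M\<^esub> (\<Oplus>\<^bsub>M\<^esub>i\<in>I. f i) = (\<Oplus>\<^bsub>M\<^esub>i\<in>I. r \<odot>\<^bsub>M\<^esub> f i)"
  using assms(1,3)
proof (induction I)
  case (insert j I)
  then have "f j \<in> carrier M" "f \<in> I \<rightarrow> carrier M" by auto
  moreover from this have "(\<lambda>i. r \<odot>\<^bsub>M\<^esub> f i) \<in> I \<rightarrow> carrier M" using assms(2) by auto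
  ultimately show ?case using insert assms(2) by (simp add: M.finsum_insert smult_r_distr)
qed (simp add: assms(2))

lemma finsum_mem_submodule:
  assumes "submodule X R M" "finite I" "\<And>i. i \<in> I \<Longrightarrow> f i \<in> X"
  shows "(\<Oplus>\<^bsub>M\<^esub>i\<in>I. f i) \<in> X"
  using assms(2,3)
proof (induction I)
  case empty
  then show ?case using submoduleD(2)[OF assms(1)] by simp
next
  case (insert j I)
  have "f j \<in> carrier M" "f \<in> I \<rightarrow> carrier M" using insert.prems submoduleD(1)[OF assms(1)] by auto
  then have "(\<Oplus>\<^bsub>M\<^esub>i\<in>insert j I. f i) = f j \<oplus>\<^bsub>M\<^esub> (\<Oplus>\<^bsub>M\<^esub>i\<in>I. f i)"
    using insert.hyps by (simp add: M.finsum_insert)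
  moreover have "f j \<in> X" "(\<Oplus>\<^bsub>M\<^esub>i\<in>I. f i) \<in> X" using insert by simp_all
  ultimately show ?case using submoduleD(3)[OF assms(1)] by simp
qed

lemma lincomb_mem_submodule:
  assumes "submodule X R M" "finite I" "r \<in> I \<rightarrow> carrier R" "\<And>i. i \<in> I \<Longrightarrow> A ! i \<in> X"
  shows "(\<Oplus>\<^bsub>M\<^esub>i\<in>I. r i \<odot>\<^bsub>M\<^esub> A ! i) \<in> X"
proof (rule finsum_mem_submodule[OF assms(1,2)])
  fix i assume "i \<in> I"
  then show "r i \<odot>\<^bsub>M\<^esub> A ! i \<in> X" using submoduleD(4)[OF assms(1)] assms(3,4) by (simp add: Pi_iff)
qed

lemma submodule_row_module:
  assumes "set A \<subseteq> carrier M"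
  shows "submodule (row_module R M A) R M"
proof (rule submoduleI)
  have A: "A ! i \<in> carrier M" if "i < length A" for i using assms that by (meson nth_mem subsetD)
  have rA: "(\<lambda>i. r i \<odot>\<^bsub>M\<^esub> A ! i) \<in> {..<length A} \<rightarrow> carrier M" if "r \<in> {..<length A} \<rightarrow> carrier R" for r
    using that A by (simp add: Pi_iff)
  show "row_module R M A \<subseteq> carrier M"
    using M.finsum_closed[OF rA] by (auto simp: row_module_def)
  have "(\<Oplus>\<^bsub>M\<^esub>i\<in>{..<length A}. \<zero>\<^bsub>R\<^esub> \<odot>\<^bsub>M\<^esub> A ! i) \<in> row_module R M A"
    unfolding row_module_def by (intro CollectI exI[of _ "\<lambda>_. \<zero>\<^bsub>R\<^esub>"]) simp
  moreover have "(\<Oplus>\<^bsub>M\<^esub>i\<in>{..<length A}. \<zero>\<^bsub>R\<^esub> \<odot>\<^bsub>M\<^esub> A ! i) \<in> {\<zero>\<^bsub>M\<^esub>}"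
    using A by (intro finsum_mem_submodule[OF submodule_zero]) simp_all
  ultimately show "\<zero>\<^bsub>M\<^esub> \<in> row_module R M A" by simp
next
  have A: "A ! i \<in> carrier M" if "i < length A" for i using assms that by (meson nth_mem subsetD)
  fix a b assume "a \<in> row_module R M A" "b \<in> row_module R M A"
  then obtain r s where r: "r \<in> {..<length A} \<rightarrow> carrier R" "a = (\<Oplus>\<^bsub>M\<^esub>i\<in>{..<length A}. r i \<odot>\<^bsub>M\<^esub> A ! i)"
    and s: "s \<in> {..<length A} \<rightarrow> carrier R" "b = (\<Oplus>\<^bsub>M\<^esub>i\<in>{..<length A}. s i \<odot>\<^bsub>M\<^esub> A ! i)"
    unfolding row_module_def by blast
  have "a \<oplus>\<^bsub>M\<^esub> b = (\<Oplus>\<^bsub>M\<^esub>i\<in>{..<length A}. r i \<odot>\<^bsub>M\<^esub> A ! i \<oplus>\<^bsub>M\<^esub> s i \<odot>\<^bsub>M\<^esub> A ! i)"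
    unfolding r(2) s(2) using r(1) s(1) A by (intro M.finsum_addf[symmetric]) (simp_all add: Pi_iff)
  also have "\<dots> = (\<Oplus>\<^bsub>M\<^esub>i\<in>{..<length A}. (r i \<oplus>\<^bsub>R\<^esub> s i) \<odot>\<^bsub>M\<^esub> A ! i)"
    using r(1) s(1) A by (intro M.finsum_cong') (simp_all add: Pi_iff smult_l_distr)
  finally show "a \<oplus>\<^bsub>M\<^esub> b \<in> row_module R M A"
    unfolding row_module_def using r(1) s(1) by (intro CollectI exI[of _ "\<lambda>i. r i \<oplus>\<^bsub>R\<^esub> s i"]) (simp add: Pi_iff)
next
  have A: "A ! i \<in> carrier M" if "i < length A" for i using assms that by (meson nth_mem subsetD)
  fix t a assume t: "t \<in> carrier R" and "a \<in> row_module R M A"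
  then obtain r where r: "r \<in> {..<length A} \<rightarrow> carrier R" "a = (\<Oplus>\<^bsub>M\<^esub>i\<in>{..<length A}. r i \<odot>\<^bsub>M\<^esub> A ! i)"
    unfolding row_module_def by blast
  have "t \<odot>\<^bsub>M\<^esub> a = (\<Oplus>\<^bsub>M\<^esub>i\<in>{..<length A}. t \<odot>\<^bsub>M\<^esub> (r i \<odot>\<^bsub>M\<^esub> A ! i))"
    unfolding r(2) using r(1) A t by (intro finsum_smult) (simp_all add: Pi_iff)
  also have "\<dots> = (\<Oplus>\<^bsub>M\<^esub>i\<in>{..<length A}. (t \<otimes>\<^bsub>R\<^esub> r i) \<odot>\<^bsub>M\<^esub> A ! i)"
    using r(1) t A by (intro M.finsum_cong') (simp_all add: Pi_iff smult_assoc1)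
  finally show "t \<odot>\<^bsub>M\<^esub> a \<in> row_module R M A"
    unfolding row_module_def using r(1) t by (intro CollectI exI[of _ "\<lambda>i. t \<otimes>\<^bsub>R\<^esub> r i"]) (simp add: Pi_iff)
qed

lemma rows_subset_row_module:
  assumes "set A \<subseteq> carrier M"
  shows "set A \<subseteq> row_module R M A"
proof
  have A: "A ! i \<in> carrier M" if "i < length A" for i using assms that by (meson nth_mem subsetD)
  fix a assume "a \<in> set A"
  then obtain k where k: "k < length A" "a = A ! k" by (metis in_set_conv_nth)
  let ?r = "\<lambda>j. if k = j then \<one>\<^bsub>R\<^esub> else \<zero>\<^bsub>R\<^esub>"
  have "(\<Oplus>\<^bsub>M\<^esub>i\<in>{..<length A}. ?r i \<odot>\<^bsub>M\<^esub> A ! i) =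
      (\<Oplus>\<^bsub>M\<^esub>i\<in>{..<length A}. if k = i then A ! i else \<zero>\<^bsub>M\<^esub>)"
    using A by (intro M.finsum_cong') (simp_all add: Pi_iff)
  also have "\<dots> = a"
    using A k by (subst M.finsum_singleton) (simp_all add: Pi_iff)
  finally show "a \<in> row_module R M A"
    unfolding row_module_def by (intro CollectI exI[of _ ?r]) (simp add: Pi_iff)
qed

lemma row_module_subset_submodule:
  assumes "submodule X R M" "set A \<subseteq> X"
  shows "row_module R M A \<subseteq> X"
proof
  fix a assume "a \<in> row_module R M A"
  then obtain r where "r \<in> {..<length A} \<rightarrow> carrier R" "a = (\<Oplus>\<^bsub>M\<^esub>i\<in>{..<length A}. r i \<odot>\<^bsub>M\<^esub> A ! i)"
    unfolding row_module_def by blast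
  moreover have "A ! i \<in> X" if "i \<in> {..<length A}" for i using assms(2) that by (meson lessThan_iff nth_mem subsetD)
  ultimately show "a \<in> X" using lincomb_mem_submodule[OF assms(1), of "{..<length A}" r A] by simp
qed

text \<open>Each list of rows lies in the span of the other. The conclusion repeats the carrier
  condition so that single steps can be chained by induction.\<close>

lemma row_module_eqI:
  assumes "set A \<subseteq> carrier M" "set B \<subseteq> row_module R M A" "set A \<subseteq> row_module R M B"
  shows "set B \<subseteq> carrier M \<and> row_module R M A = row_module R M B"
proof -
  have "set B \<subseteq> carrier M" using assms(2) submoduleD(1)[OF submodule_row_module[OF assms(1)]] by blast
  then show ?thesis
    using row_module_subset_submodule[OF submodule_row_module] assms by blast
qed

lemma row_step_row_module:
  assumes "row_step R M A B" "set A \<subseteq> carrier M"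
  shows "set B \<subseteq> carrier M \<and> row_module R M A = row_module R M B"
  using assms
proof (cases rule: row_step.cases)
  let ?N = "row_module R M A"
  have N: "submodule ?N R M" by (rule submodule_row_module[OF assms(2)])
  have A: "A ! i \<in> ?N" if "i < length A" for i
    using rows_subset_row_module[OF assms(2)] that by (meson nth_mem subsetD)
  {
    case (ER0 i r)
    let ?s = "\<Oplus>\<^bsub>M\<^esub>j\<in>{..<length A}. r j \<odot>\<^bsub>M\<^esub> A ! j"
    have s: "?s \<in> ?N" using ER0(4) A by (intro lincomb_mem_submodule[OF N]) simp_all
    have B: "set B \<subseteq> ?N"
      unfolding ER0(1) using set_update_subset_insert[of A i ?s] s rows_subset_row_module[OF assms(2)] by blast
    then have BM: "set B \<subseteq> carrier M" using submoduleD(1)[OF N] by blast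
    \<comment> \<open>The overwritten row was zero, so no generator is lost.\<close>
    have "set A \<subseteq> row_module R M B"
    proof
      fix a assume "a \<in> set A"
      then obtain k where k: "k < length A" "a = A ! k" by (metis in_set_conv_nth)
      show "a \<in> row_module R M B"
      proof (cases "k = i")
        case True
        then show ?thesis using k ER0(3) submoduleD(2)[OF submodule_row_module[OF BM]] by simp
      next
        case False
        then have "a = B ! k" "k < length B" using k unfolding ER0(1) by simp_all
        then show ?thesis using rows_subset_row_module[OF BM] by (meson nth_mem subsetD)
      qed
    qed
    then show ?thesis by (rule row_module_eqI[OF assms(2) B])
  next
    case (ER1 i r)
    let ?s = "\<Oplus>\<^bsub>M\<^esub>j\<in>{..<length A} - {i}. r j \<odot>\<^bsub>M\<^esub> A ! j"
    have s: "?s \<in> ?N" using ER1(3) A by (intro lincomb_mem_submodule[OF N]) simp_all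
    have "A ! i \<oplus>\<^bsub>M\<^esub> ?s \<in> ?N" using submoduleD(3)[OF N A[OF ER1(2)] s] .
    then have B: "set B \<subseteq> ?N"
      unfolding ER1(1) using set_update_subset_insert[of A i] rows_subset_row_module[OF assms(2)] by blast
    then have BM: "set B \<subseteq> carrier M" using submoduleD(1)[OF N] by blast
    note NB = submodule_row_module[OF BM]
    have Bk: "A ! k \<in> row_module R M B" if "k < length A" "k \<noteq> i" for k
    proof -
      have "A ! k = B ! k" "k < length B" using that unfolding ER1(1) by simp_all
      then show ?thesis using rows_subset_row_module[OF BM] by (metis nth_mem subsetD)
    qed
    \<comment> \<open>The sum involves only rows other than \<open>i\<close>, which survive
      unchanged in \<open>B\<close>; subtracting it from the new row recovers the old one.\<close>
    have s': "?s \<in> row_module R M B" using ER1(3) Bk by (intro lincomb_mem_submodule[OF NB]) simp_all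
    have "B ! i \<in> set B" unfolding ER1(1) using ER1(2) by (intro nth_mem) simp
    then have "B ! i \<ominus>\<^bsub>M\<^esub> ?s \<in> row_module R M B"
      using rows_subset_row_module[OF BM] s' by (intro submoduleD(6)[OF NB]) (rule subsetD)
    moreover have "A ! i \<in> carrier M" "?s \<in> carrier M"
      using A[OF ER1(2)] s submoduleD(1)[OF N] by (simp_all add: subsetD)
    then have "B ! i \<ominus>\<^bsub>M\<^esub> ?s = A ! i"
      unfolding ER1(1) using ER1(2) by (simp add: a_minus_def M.a_assoc M.r_neg)
    ultimately have "A ! i \<in> row_module R M B" by simp
    then have "set A \<subseteq> row_module R M B" using Bk by (metis in_set_conv_nth subsetI)
    then show ?thesis by (rule row_module_eqI[OF assms(2) B])
  next
    case (ER2 i j)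
    then have "set B = set A" by simp
    then show ?thesis using row_module_eqI[OF assms(2), of B] rows_subset_row_module[of A] rows_subset_row_module[of B] assms(2) by simp
  next
    case (add_zero_row A' B')
    then have "set B = insert \<zero>\<^bsub>M\<^esub> (set A)" by simp
    then have B: "set B \<subseteq> carrier M" "set B \<subseteq> ?N" "set A \<subseteq> set B"
      using rows_subset_row_module[OF assms(2)] submoduleD(1,2)[OF N] by auto
    then show ?thesis
      using row_module_eqI[OF assms(2), of B] rows_subset_row_module[of B] by blast
  next
    case (delete_zero_row A' B')
    then have set: "set A = insert \<zero>\<^bsub>M\<^esub> (set B)" by simp
    then have B: "set B \<subseteq> carrier M" "set B \<subseteq> ?N"
      using rows_subset_row_module[OF assms(2)] submoduleD(1)[OF N] by auto
    have "set A \<subseteq> row_module R M B"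
      unfolding set using rows_subset_row_module[OF B(1)] submoduleD(2)[OF submodule_row_module[OF B(1)]] by simp
    with B(2) show ?thesis by (rule row_module_eqI[OF assms(2)])
  }
qed

lemma row_steps_row_module:
  assumes "(row_step R M)\<^sup>*\<^sup>* A B" "set A \<subseteq> carrier M"
  shows "set B \<subseteq> carrier M \<and> row_module R M A = row_module R M B"
  using assms by (induction rule: rtranclp_induct) (use row_step_row_module in auto)

lemma row_equiv_row_module:
  assumes "row_equiv R M A B" "set A \<subseteq> carrier M" "set B \<subseteq> carrier M"
  shows "row_module R M A = row_module R M B"
  using assms row_steps_row_module[of A B] row_steps_row_module[of B A] unfolding row_equiv_def by auto

end

section \<open>Submodules of a direct sum\<close>

locale module_family = ring R
  for R :: "('r, 'x) ring_scheme" (structure) and M :: "nat \<Rightarrow> ('r, 'm, 'y) module_scheme" and n :: nat +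
  assumes left_module_summand: "i \<in> {1..n} \<Longrightarrow> left_module R (M i)"
begin

abbreviation "D \<equiv> direct_sum_module M n"

lemma direct_sum_carrier: "carrier D = (\<Pi>\<^sub>E i\<in>{1..n}. carrier (M i))"
  by (simp add: direct_sum_module_def)

lemma direct_sum_component:
  assumes "i \<in> {1..n}"
  shows "x \<in> carrier D \<Longrightarrow> x i \<in> carrier (M i)"
    and "\<zero>\<^bsub>D\<^esub> i = \<zero>\<^bsub>M i\<^esub>"
    and "(x \<oplus>\<^bsub>D\<^esub> y) i = x i \<oplus>\<^bsub>M i\<^esub> y i"
    and "(r \<odot>\<^bsub>D\<^esub> x) i = r \<odot>\<^bsub>M i\<^esub> x i"
  using assms by (auto simp: direct_sum_module_def)

text \<open>Outside \<open>{1..n}\<close> both functions are \<open>undefined\<close>, since the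
  carrier is an extensional product.\<close>

lemma direct_sum_eqI:
  assumes "x \<in> carrier D" "y \<in> carrier D" "\<And>i. i \<in> {1..n} \<Longrightarrow> x i = y i"
  shows "x = y"
  using assms unfolding direct_sum_carrier by (rule PiE_ext)

lemma direct_sum_closed:
  shows "\<zero>\<^bsub>D\<^esub> \<in> carrier D"
    and "\<lbrakk> x \<in> carrier D; y \<in> carrier D \<rbrakk> \<Longrightarrow> x \<oplus>\<^bsub>D\<^esub> y \<in> carrier D"
    and "\<lbrakk> r \<in> carrier R; x \<in> carrier D \<rbrakk> \<Longrightarrow> r \<odot>\<^bsub>D\<^esub> x \<in> carrier D"
proof -
  have "\<zero>\<^bsub>M i\<^esub> \<in> carrier (M i)" if "i \<in> {1..n}" for i
    using left_module_summand[OF that] by (simp add: left_module.axioms(2) abelian_group.axioms(1) abelian_monoid.zero_closed)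
  then show "\<zero>\<^bsub>D\<^esub> \<in> carrier D" by (auto simp: direct_sum_module_def)
  show "x \<oplus>\<^bsub>D\<^esub> y \<in> carrier D" if "x \<in> carrier D" "y \<in> carrier D"
  proof -
    have "x i \<oplus>\<^bsub>M i\<^esub> y i \<in> carrier (M i)" if i: "i \<in> {1..n}" for i
      using left_module_summand[OF i] direct_sum_component(1)[OF i] \<open>x \<in> carrier D\<close> \<open>y \<in> carrier D\<close>
      by (simp add: left_module.axioms(2) abelian_group.axioms(1) abelian_monoid.a_closed)
    then show ?thesis by (auto simp: direct_sum_module_def)
  qed
  show "r \<odot>\<^bsub>D\<^esub> x \<in> carrier D" if "r \<in> carrier R" "x \<in> carrier D"
  proof -
    have "r \<odot>\<^bsub>M i\<^esub> x i \<in> carrier (M i)" if i: "i \<in> {1..n}" for i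
      using left_module_summand[OF i] direct_sum_component(1)[OF i \<open>x \<in> carrier D\<close>] \<open>r \<in> carrier R\<close>
      by (simp add: left_module.smult_closed)
    then show ?thesis by (auto simp: direct_sum_module_def)
  qed
qed

lemma left_module_direct_sum: "left_module R D"
proof (intro left_module.intro left_module_axioms.intro abelian_groupI)
  show "ring R" by (rule ring_axioms)
  fix x assume x: "x \<in> carrier D"
  note [simp] = direct_sum_closed direct_sum_component
  show "\<zero>\<^bsub>D\<^esub> \<oplus>\<^bsub>D\<^esub> x = x"
  proof (rule direct_sum_eqI)
    fix i assume i: "i \<in> {1..n}"
    then interpret Mi: left_module R "M i" by (rule left_module_summand)
    show "(\<zero>\<^bsub>D\<^esub> \<oplus>\<^bsub>D\<^esub> x) i = x i" using i x by simp
  qed (use x in simp_all)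
  show "\<one> \<odot>\<^bsub>D\<^esub> x = x"
  proof (rule direct_sum_eqI)
    fix i assume i: "i \<in> {1..n}"
    then interpret Mi: left_module R "M i" by (rule left_module_summand)
    show "(\<one> \<odot>\<^bsub>D\<^esub> x) i = x i" using i x by simp
  qed (use x in simp_all)
  show "\<exists>y\<in>carrier D. y \<oplus>\<^bsub>D\<^esub> x = \<zero>\<^bsub>D\<^esub>"
  proof (rule bexI)
    \<comment> \<open>The group structure is still being established, so the inverse is written
      through the scalar -1, whose action is componentwise.\<close>
    show "(\<ominus> \<one>) \<odot>\<^bsub>D\<^esub> x \<in> carrier D" using x by simp
    show "(\<ominus> \<one>) \<odot>\<^bsub>D\<^esub> x \<oplus>\<^bsub>D\<^esub> x = \<zero>\<^bsub>D\<^esub>"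
    proof (rule direct_sum_eqI)
      fix i assume i: "i \<in> {1..n}"
      then interpret Mi: left_module R "M i" by (rule left_module_summand)
      show "((\<ominus> \<one>) \<odot>\<^bsub>D\<^esub> x \<oplus>\<^bsub>D\<^esub> x) i = \<zero>\<^bsub>D\<^esub> i"
        using i x by (simp add: Mi.smult_minus_one Mi.M.l_neg)
    qed (use x in simp_all)
  qed
  fix y assume y: "y \<in> carrier D"
  show "x \<oplus>\<^bsub>D\<^esub> y = y \<oplus>\<^bsub>D\<^esub> x"
  proof (rule direct_sum_eqI)
    fix i assume i: "i \<in> {1..n}"
    then interpret Mi: left_module R "M i" by (rule left_module_summand)
    show "(x \<oplus>\<^bsub>D\<^esub> y) i = (y \<oplus>\<^bsub>D\<^esub> x) i" using i x y by (simp add: Mi.M.a_comm)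
  qed (use x y in simp_all)
  fix z assume z: "z \<in> carrier D"
  show "x \<oplus>\<^bsub>D\<^esub> y \<oplus>\<^bsub>D\<^esub> z = x \<oplus>\<^bsub>D\<^esub> (y \<oplus>\<^bsub>D\<^esub> z)"
  proof (rule direct_sum_eqI)
    fix i assume i: "i \<in> {1..n}"
    then interpret Mi: left_module R "M i" by (rule left_module_summand)
    show "(x \<oplus>\<^bsub>D\<^esub> y \<oplus>\<^bsub>D\<^esub> z) i = (x \<oplus>\<^bsub>D\<^esub> (y \<oplus>\<^bsub>D\<^esub> z)) i" using i x y z by (simp add: Mi.M.a_assoc)
  qed (use x y z in simp_all)
next
  note [simp] = direct_sum_closed direct_sum_component
  fix r x assume r: "r \<in> carrier R" and x: "x \<in> carrier D"
  fix y assume y: "y \<in> carrier D"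
  show "r \<odot>\<^bsub>D\<^esub> (x \<oplus>\<^bsub>D\<^esub> y) = r \<odot>\<^bsub>D\<^esub> x \<oplus>\<^bsub>D\<^esub> r \<odot>\<^bsub>D\<^esub> y"
  proof (rule direct_sum_eqI)
    fix i assume i: "i \<in> {1..n}"
    then interpret Mi: left_module R "M i" by (rule left_module_summand)
    show "(r \<odot>\<^bsub>D\<^esub> (x \<oplus>\<^bsub>D\<^esub> y)) i = (r \<odot>\<^bsub>D\<^esub> x \<oplus>\<^bsub>D\<^esub> r \<odot>\<^bsub>D\<^esub> y) i"
      using i r x y by (simp add: Mi.smult_r_distr)
  qed (use r x y in simp_all)
next
  note [simp] = direct_sum_closed direct_sum_component
  fix r s x assume r: "r \<in> carrier R" and s: "s \<in> carrier R" and x: "x \<in> carrier D"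
  show "(r \<oplus> s) \<odot>\<^bsub>D\<^esub> x = r \<odot>\<^bsub>D\<^esub> x \<oplus>\<^bsub>D\<^esub> s \<odot>\<^bsub>D\<^esub> x"
  proof (rule direct_sum_eqI)
    fix i assume i: "i \<in> {1..n}"
    then interpret Mi: left_module R "M i" by (rule left_module_summand)
    show "((r \<oplus> s) \<odot>\<^bsub>D\<^esub> x) i = (r \<odot>\<^bsub>D\<^esub> x \<oplus>\<^bsub>D\<^esub> s \<odot>\<^bsub>D\<^esub> x) i"
      using i r s x by (simp add: Mi.smult_l_distr)
  qed (use r s x in simp_all)
  show "(r \<otimes> s) \<odot>\<^bsub>D\<^esub> x = r \<odot>\<^bsub>D\<^esub> (s \<odot>\<^bsub>D\<^esub> x)"
  proof (rule direct_sum_eqI)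
    fix i assume i: "i \<in> {1..n}"
    then interpret Mi: left_module R "M i" by (rule left_module_summand)
    show "((r \<otimes> s) \<odot>\<^bsub>D\<^esub> x) i = (r \<odot>\<^bsub>D\<^esub> (s \<odot>\<^bsub>D\<^esub> x)) i"
      using i r s x by (simp add: Mi.smult_assoc1)
  qed (use r s x in simp_all)
qed (use direct_sum_closed in simp_all)

sublocale D: left_module R D
  by (rule left_module_direct_sum)

text \<open>Negation in \<open>D\<close> is not given by a formula in components; as multiplication
  by -1 it becomes one.\<close>

lemma direct_sum_minus_component:
  assumes "i \<in> {1..n}" "x \<in> carrier D" "y \<in> carrier D"
  shows "(x \<ominus>\<^bsub>D\<^esub> y) i = x i \<ominus>\<^bsub>M i\<^esub> y i"
proof -
  interpret Mi: left_module R "M i" by (rule left_module_summand[OF assms(1)])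
  have "(\<ominus>\<^bsub>D\<^esub> y) i = \<ominus>\<^bsub>M i\<^esub> y i"
    using assms D.smult_minus_one[OF assms(3)] Mi.smult_minus_one[of "y i"] direct_sum_component
    by metis
  then show ?thesis unfolding a_minus_def using direct_sum_component(3)[OF assms(1)] by simp
qed

section \<open>The filtration by tails and its graded parts\<close>

lemma tail_part_subset: "tail_part M n X i \<subseteq> X"
  by (auto simp: tail_part_def)

lemma tail_partD: "\<lbrakk> x \<in> tail_part M n X i; k \<in> {1..n}; k < i \<rbrakk> \<Longrightarrow> x k = \<zero>\<^bsub>M k\<^esub>"
  by (simp add: tail_part_def)

lemma tail_part_mono: "X \<subseteq> Y \<Longrightarrow> tail_part M n X i \<subseteq> tail_part M n Y i"
  by (auto simp: tail_part_def)

lemma graded_part_mono: "X \<subseteq> Y \<Longrightarrow> graded_part M n X i \<subseteq> graded_part M n Y i"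
  unfolding graded_part_def by (intro image_mono tail_part_mono)

text \<open>Lifts a submodule \<open>C\<close> of the summand to the part of the tail lying over it.
  Taking \<open>C\<close> to be the whole summand gives the tail itself; proper choices of
  \<open>C\<close> refine the filtration between two consecutive tails.\<close>

lemma submodule_tail_restrict:
  assumes "submodule X R D" "i \<in> {1..n}" "submodule C R (M i)"
  shows "submodule {x \<in> tail_part M n X i. x i \<in> C} R D"
proof (rule D.submoduleI)
  interpret Mi: left_module R "M i" by (rule left_module_summand[OF assms(2)])
  note X = D.submoduleD[OF assms(1)] and C = Mi.submoduleD[OF assms(3)]
  have zero: "\<zero>\<^bsub>M k\<^esub> \<oplus>\<^bsub>M k\<^esub> \<zero>\<^bsub>M k\<^esub> = \<zero>\<^bsub>M k\<^esub>" "r \<in> carrier R \<Longrightarrow> r \<odot>\<^bsub>M k\<^esub> \<zero>\<^bsub>M k\<^esub> = \<zero>\<^bsub>M k\<^esub>"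
    if "k \<in> {1..n}" for k r
  proof -
    interpret Mk: left_module R "M k" by (rule left_module_summand[OF that])
    show "\<zero>\<^bsub>M k\<^esub> \<oplus>\<^bsub>M k\<^esub> \<zero>\<^bsub>M k\<^esub> = \<zero>\<^bsub>M k\<^esub>" by simp
    show "r \<in> carrier R \<Longrightarrow> r \<odot>\<^bsub>M k\<^esub> \<zero>\<^bsub>M k\<^esub> = \<zero>\<^bsub>M k\<^esub>" by simp
  qed
  show "{x \<in> tail_part M n X i. x i \<in> C} \<subseteq> carrier D" using X(1) tail_part_subset by blast
  show "\<zero>\<^bsub>D\<^esub> \<in> {x \<in> tail_part M n X i. x i \<in> C}"
    using X(2) C(2) assms(2) by (simp add: tail_part_def direct_sum_component(2))
  show "x \<oplus>\<^bsub>D\<^esub> y \<in> {x \<in> tail_part M n X i. x i \<in> C}"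
    if "x \<in> {x \<in> tail_part M n X i. x i \<in> C}" "y \<in> {x \<in> tail_part M n X i. x i \<in> C}" for x y
    using that assms(2) X(3) C(3) by (simp add: tail_part_def direct_sum_component(3) zero)
  show "r \<odot>\<^bsub>D\<^esub> x \<in> {x \<in> tail_part M n X i. x i \<in> C}"
    if "r \<in> carrier R" "x \<in> {x \<in> tail_part M n X i. x i \<in> C}" for r x
    using that assms(2) X(4) C(4) by (simp add: tail_part_def direct_sum_component(4) zero)
qed

lemma submodule_tail_part:
  assumes "submodule X R D" "i \<in> {1..n}"
  shows "submodule (tail_part M n X i) R D"
proof -
  interpret Mi: left_module R "M i" by (rule left_module_summand[OF assms(2)])
  have "tail_part M n X i = {x \<in> tail_part M n X i. x i \<in> carrier (M i)}"
    using D.submoduleD(1)[OF assms(1)] direct_sum_component(1)[OF assms(2)] tail_part_subset by blast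
  then show ?thesis using submodule_tail_restrict[OF assms Mi.submodule_carrier] by simp
qed

lemma submodule_graded_part:
  assumes "submodule X R D" "i \<in> {1..n}"
  shows "submodule (graded_part M n X i) R (M i)"
proof -
  interpret Mi: left_module R "M i" by (rule left_module_summand[OF assms(2)])
  note T = D.submoduleD[OF submodule_tail_part[OF assms]]
  show ?thesis
  proof (rule Mi.submoduleI)
    show "graded_part M n X i \<subseteq> carrier (M i)"
      unfolding graded_part_def using T(1) direct_sum_component(1)[OF assms(2)] by blast
    show "\<zero>\<^bsub>M i\<^esub> \<in> graded_part M n X i"
      unfolding graded_part_def using T(2) direct_sum_component(2)[OF assms(2)] by (metis imageI)
    show "x \<oplus>\<^bsub>M i\<^esub> y \<in> graded_part M n X i"
      if "x \<in> graded_part M n X i" "y \<in> graded_part M n X i" for x y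
      using that T(3) direct_sum_component(3)[OF assms(2), symmetric] unfolding graded_part_def by fast
    show "r \<odot>\<^bsub>M i\<^esub> x \<in> graded_part M n X i"
      if "r \<in> carrier R" "x \<in> graded_part M n X i" for r x
      using that T(4) direct_sum_component(4)[OF assms(2), symmetric] unfolding graded_part_def by fast
  qed
qed

text \<open>Subtraction cancels the leading coordinate: the kernel of the projection of a tail to
  its graded part is the next tail.\<close>

lemma tail_diff_mem:
  assumes "submodule X R D" "i \<in> {1..n}" "x \<in> tail_part M n X i" "y \<in> tail_part M n X i" "x i = y i"
  shows "x \<ominus>\<^bsub>D\<^esub> y \<in> tail_part M n X (Suc i)"
proof -
  have T: "x \<ominus>\<^bsub>D\<^esub> y \<in> tail_part M n X i"
    using D.submoduleD(6)[OF submodule_tail_part[OF assms(1,2)]] assms(3,4) .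
  have xy: "x \<in> carrier D" "y \<in> carrier D"
    using D.submoduleD(1)[OF assms(1)] tail_part_subset assms(3,4) by blast+
  interpret Mi: left_module R "M i" by (rule left_module_summand[OF assms(2)])
  have "(x \<ominus>\<^bsub>D\<^esub> y) i = \<zero>\<^bsub>M i\<^esub>"
    using direct_sum_minus_component[OF assms(2) xy] assms(5) direct_sum_component(1)[OF assms(2) xy(2)]
    by (simp add: a_minus_def Mi.M.r_neg)
  then show ?thesis using T by (auto simp: tail_part_def less_Suc_eq)
qed

text \<open>Downward induction on the tails of \<open>Y\<close>, from index \<open>Suc n\<close>,
  where the tail is zero, to index 1, where it is all of \<open>Y\<close>. An element of
  \<open>Y\<close> is corrected by an element of \<open>X\<close> with the same leading coordinate,
  and the difference lies in the next tail.\<close>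

lemma submodule_eq_if_graded_eq:
  assumes X: "submodule X R D" and Y: "submodule Y R D" and sub: "X \<subseteq> Y"
    and gr: "\<And>i. i \<in> {1..n} \<Longrightarrow> graded_part M n X i = graded_part M n Y i"
  shows "X = Y"
proof -
  have "tail_part M n Y i \<subseteq> X" if "1 \<le> i" "i \<le> Suc n" for i
    using that(2,1)
  proof (induction i rule: inc_induct)
    case base
    show ?case
    proof
      fix y assume y: "y \<in> tail_part M n Y (Suc n)"
      then have "y \<in> carrier D" using D.submoduleD(1)[OF Y] tail_part_subset by blast
      then have "y = \<zero>\<^bsub>D\<^esub>"
        using tail_partD[OF y] direct_sum_closed(1) by (intro direct_sum_eqI) (simp_all add: direct_sum_component(2))
      then show "y \<in> X" using D.submoduleD(2)[OF X] by simp
    qed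
  next
    case (step i)
    have i: "i \<in> {1..n}" using step by simp
    show ?case
    proof
      fix y assume y: "y \<in> tail_part M n Y i"
      then have "y i \<in> graded_part M n X i" unfolding gr[OF i] by (simp add: graded_part_def)
      then obtain x where x: "x \<in> tail_part M n X i" "y i = x i" by (auto simp: graded_part_def)
      then have xX: "x \<in> X" and xY: "x \<in> tail_part M n Y i"
        using tail_part_subset tail_part_mono[OF sub] by blast+
      have "y \<ominus>\<^bsub>D\<^esub> x \<in> X" using tail_diff_mem[OF Y i y xY x(2)] step.IH step.prems by auto
      moreover have "y \<in> carrier D" "x \<in> carrier D"
        using D.submoduleD(1)[OF Y] tail_part_subset y xY by blast+
      then have "y = (y \<ominus>\<^bsub>D\<^esub> x) \<oplus>\<^bsub>D\<^esub> x" by (simp add: a_minus_def D.M.a_assoc D.M.l_neg)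
      ultimately show "y \<in> X" using D.submoduleD(3)[OF X _ xX] by metis
    qed
  qed
  from this[of 1] have "tail_part M n Y 1 \<subseteq> X" by simp
  moreover have "tail_part M n Y 1 = Y" by (auto simp: tail_part_def)
  ultimately show ?thesis using sub by simp
qed

section \<open>Length of an interval as the sum over its graded parts\<close>

lemma chain_length_interval_le:
  assumes "submodule N R D" "submodule L R D"
  shows "chain_length {X. submodule X R D \<and> N \<subseteq> X \<and> X \<subseteq> L} \<le>
    (\<Sum>i=1..n. chain_length {C. submodule C R (M i) \<and> graded_part M n N i \<subseteq> C \<and> C \<subseteq> graded_part M n L i})"
proof (rule chain_length_le_sum[where f = "\<lambda>i X. graded_part M n X i"])
  fix X Y
  assume "X \<in> {X. submodule X R D \<and> N \<subseteq> X \<and> X \<subseteq> L}" "Y \<in> {X. submodule X R D \<and> N \<subseteq> X \<and> X \<subseteq> L}" "X \<subset> Y"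
  then show "\<exists>i\<in>{1..n}. graded_part M n X i \<noteq> graded_part M n Y i"
    using submodule_eq_if_graded_eq[of X Y] by blast
next
  fix i X assume "i \<in> {1..n}" "X \<in> {X. submodule X R D \<and> N \<subseteq> X \<and> X \<subseteq> L}"
  then show "graded_part M n X i \<in> {C. submodule C R (M i) \<and> graded_part M n N i \<subseteq> C \<and> C \<subseteq> graded_part M n L i}"
    using submodule_graded_part graded_part_mono by simp
qed (simp_all add: graded_part_mono psubset_imp_subset)

text \<open>The lift \<open>?f i C\<close> lies between the sums of \<open>N\<close> with the tails
  of \<open>L\<close> at \<open>Suc i\<close> and at \<open>i\<close>. Thus lifts at different
  indices are stacked, and strictness at a fixed index remains to be checked.\<close>

lemma chain_length_interval_ge:
  assumes N: "submodule N R D" and L: "submodule L R D" and NL: "N \<subseteq> L"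
  shows "(\<Sum>i=1..n. chain_length {C. submodule C R (M i) \<and> graded_part M n N i \<subseteq> C \<and> C \<subseteq> graded_part M n L i}) \<le>
    chain_length {X. submodule X R D \<and> N \<subseteq> X \<and> X \<subseteq> L}"
proof -
  let ?C = "\<lambda>i. {C. submodule C R (M i) \<and> graded_part M n N i \<subseteq> C \<and> C \<subseteq> graded_part M n L i}"
  let ?f = "\<lambda>i C. N <+>\<^bsub>D\<^esub> {x \<in> tail_part M n L i. x i \<in> C}"
  have "chain_length (?C i) \<le> chain_length (?f i ` ?C i)" if i: "i \<in> {1..n}" for i
  proof (rule chain_length_map_le[where f = "?f i"])
    interpret Mi: left_module R "M i" by (rule left_module_summand[OF i])
    fix C C' assume C: "C \<in> ?C i" and C': "C' \<in> ?C i" and CC': "C \<subset> C'"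
    then have sC: "submodule C R (M i)" and NC: "graded_part M n N i \<subseteq> C" by auto
    have "?f i C \<noteq> ?f i C'"
    proof
      assume eq: "?f i C = ?f i C'"
      obtain c where c: "c \<in> C'" "c \<notin> C" using CC' by blast
      then have "c \<in> graded_part M n L i" using C' by blast
      then obtain x where x: "x \<in> tail_part M n L i" "x i = c" by (auto simp: graded_part_def)
      have "submodule {x \<in> tail_part M n L i. x i \<in> C'} R D"
        using submodule_tail_restrict[OF L i] C' by simp
      then have "x \<in> ?f i C'" using D.submodule_set_add(3)[OF N] x c by blast
      then have "x \<in> ?f i C" unfolding eq .
      then obtain y z where yz: "y \<in> N" "z \<in> {x \<in> tail_part M n L i. x i \<in> C}" "x = y \<oplus>\<^bsub>D\<^esub> z"
        by (rule D.set_addE)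
      then have z: "z \<in> tail_part M n L i" "z i \<in> C" by simp_all
      have carr: "x \<in> carrier D" "y \<in> carrier D" "z \<in> carrier D"
        using D.submoduleD(1)[OF L] D.submoduleD(1)[OF N] tail_part_subset x z yz(1) by blast+
      \<comment> \<open>A difference of elements of the tail, \<open>y\<close> lies in that tail, so
        its leading coordinate belongs to gr(N)_i and hence to \<open>C\<close>: adding
        \<open>N\<close> creates no new leading coordinates.\<close>
      have "y = x \<ominus>\<^bsub>D\<^esub> z" unfolding yz(3) using carr by (simp add: a_minus_def D.M.a_assoc D.M.r_neg)
      then have "y \<in> tail_part M n L i" using D.submoduleD(6)[OF submodule_tail_part[OF L i] x(1) z(1)] by simp
      then have "y i \<in> C" using yz(1) NC by (auto simp: tail_part_def graded_part_def)
      then have "y i \<oplus>\<^bsub>M i\<^esub> z i \<in> C" using z(2) by (rule Mi.submoduleD(3)[OF sC])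
      then show False using c(2) x(2) yz(3) direct_sum_component(3)[OF i] by simp
    qed
    moreover have "?f i C \<subseteq> ?f i C'" using CC' by (intro D.set_add_mono) auto
    ultimately show "?f i C \<subset> ?f i C'" by blast
  qed simp
  then have "(\<Sum>i=1..n. chain_length (?C i)) \<le> (\<Sum>i=1..n. chain_length (?f i ` ?C i))"
    by (rule sum_mono)
  also have "\<dots> \<le> chain_length {X. submodule X R D \<and> N \<subseteq> X \<and> X \<subseteq> L}"
  proof (rule sum_chain_length_le)
    fix i assume i: "i \<in> {1..n}"
    show "?f i ` ?C i \<subseteq> {X. submodule X R D \<and> N \<subseteq> X \<and> X \<subseteq> L}"
    proof (rule image_subsetI)
      fix C assume "C \<in> ?C i"
      then have "submodule {x \<in> tail_part M n L i. x i \<in> C} R D" using submodule_tail_restrict[OF L i] by simp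
      then have "submodule (?f i C) R D" "N \<subseteq> ?f i C" by (rule D.submodule_set_add[OF N])+
      moreover have "?f i C \<subseteq> L"
        using NL tail_part_subset by (intro D.set_add_subset_submodule[OF L]) blast+
      ultimately show "?f i C \<in> {X. submodule X R D \<and> N \<subseteq> X \<and> X \<subseteq> L}" by simp
    qed
  next
    fix i j X Y assume i: "i \<in> {1..n}" and j: "j \<in> {1..n}" and ij: "i < j"
      and X: "X \<in> ?f j ` ?C j" and Y: "Y \<in> ?f i ` ?C i"
    interpret Mi: left_module R "M i" by (rule left_module_summand[OF i])
    obtain C where C: "X = ?f j C" using X by blast
    obtain C' where C': "Y = ?f i C'" "submodule C' R (M i)" using Y by blast
    \<comment> \<open>At a larger index \<open>j\<close> the coordinate at \<open>i\<close>
      vanishes, and zero belongs to every \<open>C'\<close>.\<close>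
    have "{x \<in> tail_part M n L j. x j \<in> C} \<subseteq> {x \<in> tail_part M n L i. x i \<in> C'}"
      using Mi.submoduleD(2)[OF C'(2)] i ij by (auto simp: tail_part_def)
    then show "X \<subseteq> Y" unfolding C C'(1) by (intro D.set_add_mono) simp_all
  qed
  finally show ?thesis .
qed

lemma graded_part_zero:
  assumes "i \<in> {1..n}"
  shows "graded_part M n {\<zero>\<^bsub>D\<^esub>} i = {\<zero>\<^bsub>M i\<^esub>}"
proof -
  have "tail_part M n {\<zero>\<^bsub>D\<^esub>} i = {\<zero>\<^bsub>D\<^esub>}"
    unfolding tail_part_def using direct_sum_component(2) by auto
  then show ?thesis unfolding graded_part_def using direct_sum_component(2)[OF assms] by simp
qed

lemma graded_part_carrier:
  assumes "i \<in> {1..n}"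
  shows "graded_part M n (carrier D) i = carrier (M i)"
proof
  interpret Mi: left_module R "M i" by (rule left_module_summand[OF assms])
  show "graded_part M n (carrier D) i \<subseteq> carrier (M i)"
    by (rule Mi.submoduleD(1)[OF submodule_graded_part[OF D.submodule_carrier assms]])
  show "carrier (M i) \<subseteq> graded_part M n (carrier D) i"
  proof
    fix c assume c: "c \<in> carrier (M i)"
    let ?x = "\<zero>\<^bsub>D\<^esub>(i := c)"
    have "?x \<in> carrier D"
      using direct_sum_closed(1) c assms unfolding direct_sum_carrier by (auto simp: PiE_iff extensional_def)
    moreover have "?x k = \<zero>\<^bsub>M k\<^esub>" if "k \<in> {1..n}" "k < i" for k
      using direct_sum_component(2)[OF that(1)] that(2) by simp
    ultimately have "?x \<in> tail_part M n (carrier D) i" by (simp add: tail_part_def)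
    moreover have "?x i = c" by simp
    ultimately show "c \<in> graded_part M n (carrier D) i" unfolding graded_part_def by (metis imageI)
  qed
qed

lemma chain_length_submodule_eq_sum:
  assumes N: "submodule N R D"
  shows "chain_length {X. submodule X R D \<and> X \<subseteq> N} =
    (\<Sum>i=1..n. chain_length {C. submodule C R (M i) \<and> C \<subseteq> graded_part M n N i})"
proof -
  have 1: "{X. submodule X R D \<and> X \<subseteq> N} = {X. submodule X R D \<and> {\<zero>\<^bsub>D\<^esub>} \<subseteq> X \<and> X \<subseteq> N}"
    using D.submoduleD(2) by blast
  have 2: "{C. submodule C R (M i) \<and> C \<subseteq> graded_part M n N i} =
      {C. submodule C R (M i) \<and> graded_part M n {\<zero>\<^bsub>D\<^esub>} i \<subseteq> C \<and> C \<subseteq> graded_part M n N i}" if "i \<in> {1..n}" for i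
    unfolding graded_part_zero[OF that] using left_module.submoduleD(2)[OF left_module_summand[OF that]] by blast
  have "{\<zero>\<^bsub>D\<^esub>} \<subseteq> N" using D.submoduleD(2)[OF N] by simp
  then show ?thesis
    using chain_length_interval_le[OF D.submodule_zero N] chain_length_interval_ge[OF D.submodule_zero N]
    by (simp add: 1 2)
qed

lemma chain_length_quotient_eq_sum:
  assumes N: "submodule N R D"
  shows "chain_length {X. submodule X R D \<and> N \<subseteq> X} =
    (\<Sum>i=1..n. chain_length {C. submodule C R (M i) \<and> graded_part M n N i \<subseteq> C})"
proof -
  have 1: "{X. submodule X R D \<and> N \<subseteq> X} = {X. submodule X R D \<and> N \<subseteq> X \<and> X \<subseteq> carrier D}"
    using D.submoduleD(1) by blast
  have 2: "{C. submodule C R (M i) \<and> graded_part M n N i \<subseteq> C} =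
      {C. submodule C R (M i) \<and> graded_part M n N i \<subseteq> C \<and> C \<subseteq> graded_part M n (carrier D) i}" if "i \<in> {1..n}" for i
    unfolding graded_part_carrier[OF that] using left_module.submoduleD(1)[OF left_module_summand[OF that]] by blast
  show ?thesis
    using chain_length_interval_le[OF N D.submodule_carrier]
      chain_length_interval_ge[OF N D.submodule_carrier D.submoduleD(1)[OF N]]
    by (simp add: 1 2)
qed

end

section \<open>The length formulas\<close>

theorem proposition4p10:
  fixes R :: "('r, 'x) ring_scheme"
    and M :: "nat \<Rightarrow> ('r, 'm) module"
    and P :: "nat \<Rightarrow> 'p gorder"
    and d :: "nat \<Rightarrow> 'm \<Rightarrow> 'p"
    and n m s :: nat
    and A B :: "(nat \<Rightarrow> 'm) list"
    and js :: "nat list"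
  assumes "ring R"
    and "\<And>i. i \<in> {1..n} \<Longrightarrow> l_finite_euclidean_module R (M i) (P i) (d i)"
    and "A \<in> module_matrices M m n"
    and "nonzero_matrix M n A"
    and "set js = strong_pivots M n (row_module R (direct_sum_module M n) A)"
    and "sorted_wrt (<) js"
    and "length js = s"
    and "B \<in> module_matrices M s n"
    and "row_equiv R (direct_sum_module M n) A B"
    and "\<And>\<nu> k. \<nu> < s \<Longrightarrow> k \<in> {1..n} \<Longrightarrow> k < js ! \<nu> \<Longrightarrow> (B ! \<nu>) k = \<zero>\<^bsub>M k\<^esub>"
    and "strong_reduced_echelon R M n P d B"
  shows "
    let D = direct_sum_module M n; N = row_module R D A; J = strong_pivots M n N in
      (module_length R (submodule_as_module D N) < \<infinity> \<longleftrightarrow>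
        (\<forall>j\<in>J. module_length R (M j) < \<infinity>)) \<and>
      (module_length R (submodule_as_module D N) < \<infinity> \<longrightarrow>
        module_length R (submodule_as_module D N) =
          (\<Sum>\<nu><s. module_length R (submodule_as_module (M (js ! \<nu>))
            (cyclic_submodule R (M (js ! \<nu>)) ((B ! \<nu>) (js ! \<nu>)))))) \<and>
      (module_length R (quotient_module D N) < \<infinity> \<longleftrightarrow>
        (\<forall>j\<in>{1..n} - J. module_length R (M j) < \<infinity>)) \<and>
      (module_length R (quotient_module D N) < \<infinity> \<longrightarrow>
        module_length R (quotient_module D N) =
          (\<Sum>\<nu><s. module_length R (quotient_module (M (js ! \<nu>))
            (cyclic_submodule R (M (js ! \<nu>)) ((B ! \<nu>) (js ! \<nu>))))) +
          (\<Sum>j\<in>{1..n} - J. module_length R (M j)))"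
proof -
  interpret module_family R M n
  proof (intro module_family.intro module_family_axioms.intro)
    show "ring R" by (rule assms(1))
    show "left_module R (M i)" if "i \<in> {1..n}" for i
      using assms(2)[OF that]
      by (blast dest: euclidean_module.axioms(1) l_finite_euclidean_module.axioms(1))
  qed
  let ?N = "row_module R D A"
  let ?J = "strong_pivots M n ?N"
  let ?gr = "graded_part M n ?N"
  \<comment> \<open>\<open>sub j\<close> and \<open>quo j\<close> are the lengths of gr(N)_j and
    M_j/gr(N)_j, expressed as intervals of submodules of the same summand.\<close>
  define sub where "sub j = chain_length {C. submodule C R (M j) \<and> C \<subseteq> ?gr j}" for j
  define quo where "quo j = chain_length {C. submodule C R (M j) \<and> ?gr j \<subseteq> C}" for j
  have A: "set A \<subseteq> carrier D" and B: "set B \<subseteq> carrier D"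
    using assms(3,8) by (simp_all add: module_matrices_def)
  \<comment> \<open>Transfers the echelon conditions, which speak of the row module of
    \<open>B\<close>, to that of \<open>A\<close>.\<close>
  have NB: "row_module R D B = ?N"
    using D.row_equiv_row_module[OF assms(9) A B] by simp
  have N: "submodule ?N R D" by (rule D.submodule_row_module[OF A])
  obtain js' where js': "sorted_wrt (<) js'" "set js' = ?J"
    and ech: "\<And>\<nu>. \<nu> < length js' \<Longrightarrow> ?gr (js' ! \<nu>) = cyclic_submodule R (M (js' ! \<nu>)) ((B ! \<nu>) (js' ! \<nu>)) \<and>
      least_degree_in (M (js' ! \<nu>)) (P (js' ! \<nu>)) (d (js' ! \<nu>)) (?gr (js' ! \<nu>)) ((B ! \<nu>) (js' ! \<nu>))"
    using assms(11) unfolding strong_reduced_echelon_def NB Let_def by blast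
  \<comment> \<open>The echelon form brings its own enumeration of the pivots; a finite set has just
    one strictly increasing enumeration.\<close>
  have "js' = js"
    by (rule strict_sorted_equal) (use js' assms(5,6) in simp_all)
  have J: "?J \<subseteq> {1..n}" "finite ?J" by (auto simp: strong_pivots_def)
  have gr: "?gr (js ! \<nu>) = cyclic_submodule R (M (js ! \<nu>)) ((B ! \<nu>) (js ! \<nu>))"
    and pivot: "(B ! \<nu>) (js ! \<nu>) \<in> ?gr (js ! \<nu>)" "(B ! \<nu>) (js ! \<nu>) \<noteq> \<zero>\<^bsub>M (js ! \<nu>)\<^esub>"
    and jsn: "js ! \<nu> \<in> {1..n}" if "\<nu> < s" for \<nu>
  proof -
    have "\<nu> < length js'" using that assms(7) \<open>js' = js\<close> by simp
    from ech[OF this] show "?gr (js ! \<nu>) = cyclic_submodule R (M (js ! \<nu>)) ((B ! \<nu>) (js ! \<nu>))"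
      "(B ! \<nu>) (js ! \<nu>) \<in> ?gr (js ! \<nu>)" "(B ! \<nu>) (js ! \<nu>) \<noteq> \<zero>\<^bsub>M (js ! \<nu>)\<^esub>"
      unfolding \<open>js' = js\<close> least_degree_in_def by blast+
    have "js ! \<nu> \<in> ?J" unfolding assms(5)[symmetric] using that assms(7) by simp
    then show "js ! \<nu> \<in> {1..n}" using J(1) by (rule subsetD[rotated])
  qed
  have sum_J: "(\<Sum>j\<in>?J. f j) = (\<Sum>\<nu><s. f (js ! \<nu>))" for f :: "nat \<Rightarrow> enat"
  proof -
    have "bij_betw ((!) js) {..<s} ?J"
      using assms(5,6,7) by (intro bij_betw_nth) (simp_all add: strict_sorted_iff)
    then show ?thesis by (simp add: sum.reindex_bij_betw)
  qed
  have mod: "submodule {\<zero>\<^bsub>M j\<^esub>} R (M j)" "submodule (?gr j) R (M j)"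
    "\<And>C. submodule C R (M j) \<Longrightarrow> \<zero>\<^bsub>M j\<^esub> \<in> C" if "j \<in> {1..n}" for j
    using submodule_graded_part[OF N that] left_module.submodule_zero[OF left_module_summand[OF that]]
      left_module.submoduleD(2)[OF left_module_summand[OF that]] by simp_all
  \<comment> \<open>Off the pivots gr(N)_j is zero: below it there is a single submodule, above it
    there are all of them.\<close>
  have off: "sub j = 0" "quo j = module_length R (M j)" if j: "j \<in> {1..n} - ?J" for j
  proof -
    have j': "j \<in> {1..n}" and gr0: "?gr j = {\<zero>\<^bsub>M j\<^esub>}" using j by (auto simp: strong_pivots_def)
    have "{C. submodule C R (M j) \<and> C \<subseteq> ?gr j} = {{\<zero>\<^bsub>M j\<^esub>}}"
      unfolding gr0 using mod(1,3)[OF j'] by blast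
    then show "sub j = 0" unfolding sub_def by (simp add: chain_length_singleton)
    have "{C. submodule C R (M j) \<and> ?gr j \<subseteq> C} = {C. submodule C R (M j)}"
      unfolding gr0 using mod(3)[OF j'] by blast
    then show "quo j = module_length R (M j)" unfolding quo_def module_length_eq by simp
  qed
  \<comment> \<open>The pivot entry is a nonzero generator of gr(N)_j, which makes
    \<open>quo j\<close> finite; the second claim follows from the bounds \<open>sub j\<close> \<le>
    l(M_j) \<le> \<open>sub j + quo j\<close>.\<close>
  have on: "quo j < \<infinity>" "sub j < \<infinity> \<longleftrightarrow> module_length R (M j) < \<infinity>" if j: "j \<in> ?J" for j
  proof -
    obtain \<nu> where \<nu>: "\<nu> < s" "j = js ! \<nu>"
      using j assms(7) unfolding assms(5)[symmetric] by (auto simp: in_set_conv_nth)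
    have j': "j \<in> {1..n}" using j J(1) by (rule subsetD[rotated])
    interpret Mj: l_finite_euclidean_module R "M j" "P j" "d j" by (rule assms(2)[OF j'])
    have "(B ! \<nu>) j \<in> carrier (M j)"
      using pivot(1)[OF \<nu>(1)] Mj.submoduleD(1)[OF mod(2)[OF j']] unfolding \<nu>(2) by (rule subsetD[rotated])
    then show quo: "quo j < \<infinity>"
      unfolding quo_def using Mj.chain_length_above_nonzero_finite gr[OF \<nu>(1)] pivot(2)[OF \<nu>(1)] \<nu>(2) by simp
    have "module_length R (M j) \<le> sub j + quo j"
      unfolding module_length_eq sub_def quo_def by (rule Mj.chain_length_subadd[OF mod(2)[OF j']])
    moreover have "sub j \<le> module_length R (M j)"
      unfolding module_length_eq sub_def by (rule chain_length_mono) blast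
    ultimately show "sub j < \<infinity> \<longleftrightarrow> module_length R (M j) < \<infinity>"
      using quo by (cases "sub j"; cases "quo j"; cases "module_length R (M j)") auto
  qed
  have split: "(\<Sum>i=1..n. f i) = (\<Sum>j\<in>?J. f j) + (\<Sum>j\<in>{1..n} - ?J. f j)" for f :: "nat \<Rightarrow> enat"
    using sum.subset_diff[OF J(1), of f] by (simp add: add.commute)
  have lenN: "module_length R (submodule_as_module D ?N) = (\<Sum>j\<in>?J. sub j)"
    unfolding D.module_length_submodule_as_module[OF N] chain_length_submodule_eq_sum[OF N]
      sub_def[symmetric] split by (simp add: off)
  have lenQ: "module_length R (quotient_module D ?N) =
      (\<Sum>j\<in>?J. quo j) + (\<Sum>j\<in>{1..n} - ?J. module_length R (M j))"
    unfolding D.module_length_quotient_module[OF N] chain_length_quotient_eq_sum[OF N]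
      quo_def[symmetric] split using off(2) by simp
  have subN: "(\<Sum>j\<in>?J. sub j) = (\<Sum>\<nu><s. module_length R (submodule_as_module (M (js ! \<nu>))
      (cyclic_submodule R (M (js ! \<nu>)) ((B ! \<nu>) (js ! \<nu>)))))"
    unfolding sum_J
  proof (rule sum.cong[OF refl])
    fix \<nu> assume "\<nu> \<in> {..<s}"
    then have \<nu>: "\<nu> < s" by simp
    show "sub (js ! \<nu>) = module_length R (submodule_as_module (M (js ! \<nu>))
        (cyclic_submodule R (M (js ! \<nu>)) ((B ! \<nu>) (js ! \<nu>))))"
      unfolding gr[OF \<nu>, symmetric] sub_def using left_module_summand[OF jsn[OF \<nu>]] mod(2)[OF jsn[OF \<nu>]]
      by (rule left_module.module_length_submodule_as_module[symmetric])
  qed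
  have quoN: "(\<Sum>j\<in>?J. quo j) = (\<Sum>\<nu><s. module_length R (quotient_module (M (js ! \<nu>))
      (cyclic_submodule R (M (js ! \<nu>)) ((B ! \<nu>) (js ! \<nu>)))))"
    unfolding sum_J
  proof (rule sum.cong[OF refl])
    fix \<nu> assume "\<nu> \<in> {..<s}"
    then have \<nu>: "\<nu> < s" by simp
    show "quo (js ! \<nu>) = module_length R (quotient_module (M (js ! \<nu>))
        (cyclic_submodule R (M (js ! \<nu>)) ((B ! \<nu>) (js ! \<nu>))))"
      unfolding gr[OF \<nu>, symmetric] quo_def using left_module_summand[OF jsn[OF \<nu>]] mod(2)[OF jsn[OF \<nu>]]
      by (rule left_module.module_length_quotient_module[symmetric])
  qed
  have "(\<Sum>j\<in>?J. sub j) < \<infinity> \<longleftrightarrow> (\<forall>j\<in>?J. module_length R (M j) < \<infinity>)"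
    unfolding sum_enat_less_infinity_iff[OF J(2)] using on(2) by blast
  moreover have "(\<Sum>j\<in>?J. quo j) + (\<Sum>j\<in>{1..n} - ?J. module_length R (M j)) < \<infinity> \<longleftrightarrow>
      (\<forall>j\<in>{1..n} - ?J. module_length R (M j) < \<infinity>)"
  proof -
    have "(\<Sum>j\<in>?J. quo j) < \<infinity>"
      unfolding sum_enat_less_infinity_iff[OF J(2)] using on(1) by blast
    then have "(\<Sum>j\<in>?J. quo j) + (\<Sum>j\<in>{1..n} - ?J. module_length R (M j)) < \<infinity> \<longleftrightarrow>
        (\<Sum>j\<in>{1..n} - ?J. module_length R (M j)) < \<infinity>"
      by (cases "\<Sum>j\<in>?J. quo j"; cases "\<Sum>j\<in>{1..n} - ?J. module_length R (M j)") simp_all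
    then show ?thesis by (simp only: sum_enat_less_infinity_iff finite_Diff finite_atLeastAtMost)
  qed
  ultimately show ?thesis
    unfolding Let_def lenN lenQ subN[symmetric] quoN[symmetric] by blast
qed

end
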